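(* (a) For every $n\ge1$ the graph $\Gamma(bS_n)$ is connected, and it is planar if and only if $n\le 6$. (b) $\Gamma(cS_n)$ is connected if and only if $n\le4$. (c) $\Gamma(gS_n)$ is connected if and only if $n\le3$.
   Context: Permutations act on $[n]$; products composed right to left; $\tau_i=(i,i+1)$, $1\le i\le n-1$. For $A\subseteq\Sigma_n$, $\Gamma(A)$ is the induced subgraph of the Cayley graph of $\Sigma_n$ with respect to $\tau_1,\dots,\tau_{n-1}$: vertex set $A$, with an edge $a$—$b$ whenever $b=a\tau_i$ for some $i$. $bS_n$: with $D(k,j)=\tau_k\tau_{k-1}\cdots\tau_j$ ($1\le j\le k\le n-1$), every $\pi\ne\mathrm{Id}$ has a unique expression $\pi=D(k_1,j_1)\cdots D(k_s,j_s)$ with $1\le k_1<\dots<k_s\le n-1$, $j_a\le k_a$, of length equal to the Coxeter length of $\pi$; $\pi\in bS_n$ if $\pi=\mathrm{Id}$ or each $\tau_i$ occurs at most once in this word. $cS_n$: permutations whose disjoint cycle decomposition has at most one cycle of length $\ge2$. $gS_n$: permutations $\pi$ such that the cyclic group $\langle\pi\rangle$ is simple (the identity included). *)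

theory Defs
  imports
    "HOL-Analysis.Analysis"
    "HOL-Algebra.Sym_Groups"
    "HOL-Algebra.SimpleGroups"
    "HOL-Combinatorics.Orbits"
    "Graph_Theory.Pair_Digraph"
    "Graph_Theory.Digraph_Component"
begin

definition tau :: "nat \<Rightarrow> nat \<Rightarrow> nat" where
  "tau i = Transposition.transpose i (Suc i)"

text \<open>An undirected graph is represented, as usual for \<^theory>\<open>Graph_Theory.Digraph\<close>, by a
  symmetric digraph. The relation below is symmetric whenever \<open>S\<close> is closed under inverses,
  as it is for the involutions \<open>tau i\<close>.\<close>

definition cayley_graph :: "('a, 'b) monoid_scheme \<Rightarrow> 'a set \<Rightarrow> 'a pair_pre_digraph" where
  "cayley_graph G S =
    \<lparr> pverts = carrier G,
      parcs = {(a, b). a \<in> carrier G \<and> b \<in> carrier G \<and> (\<exists>s\<in>S. b = a \<otimes>\<^bsub>G\<^esub> s)} \<rparr>"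

definition Gamma_graph :: "nat \<Rightarrow> (nat \<Rightarrow> nat) set \<Rightarrow> (nat \<Rightarrow> nat, (nat \<Rightarrow> nat) \<times> (nat \<Rightarrow> nat)) pre_digraph"
  where "Gamma_graph n A = with_proj (cayley_graph (sym_group n) (tau ` {1..n - 1})) \<restriction> A"

text \<open>A word in the generators is the list of their indices, and \<open>D_word k j\<close> is the list
  \<open>[k, k - 1, \<dots>, j]\<close>.\<close>

definition word_perm :: "nat list \<Rightarrow> nat \<Rightarrow> nat" where
  "word_perm w = foldr (\<lambda>i p. tau i \<circ> p) w id"

definition D_word :: "nat \<Rightarrow> nat \<Rightarrow> nat list" where
  "D_word k j = rev [j..<Suc k]"

definition canonical_word :: "nat \<Rightarrow> nat list \<Rightarrow> bool" where
  "canonical_word n w \<longleftrightarrow>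
    (\<exists>kjs. sorted_wrt (<) (map fst kjs) \<and>
           (\<forall>(k, j)\<in>set kjs. 1 \<le> j \<and> j \<le> k \<and> k \<le> n - 1) \<and>
           w = concat (map (\<lambda>(k, j). D_word k j) kjs))"

text \<open>Every permutation has exactly one canonical word, so that the existential quantifier
  speaks about the canonical word of \<open>p\<close>; the identity has the empty one.\<close>

definition bS :: "nat \<Rightarrow> (nat \<Rightarrow> nat) set" where
  "bS n = {p \<in> carrier (sym_group n). \<exists>w. canonical_word n w \<and> word_perm w = p \<and> distinct w}"

text \<open>The supports of the disjoint cycles of a permutation are its orbits.\<close>

definition cS :: "nat \<Rightarrow> (nat \<Rightarrow> nat) set" where
  "cS n = {p \<in> carrier (sym_group n). card {C \<in> Orbits.orbit p ` {1..n}. card C \<ge> 2} \<le> 1}"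

text \<open>The predicate \<^const>\<open>simple_group\<close> excludes the trivial group, hence the
  separate clause for the identity.\<close>

definition gS :: "nat \<Rightarrow> (nat \<Rightarrow> nat) set" where
  "gS n = {p \<in> carrier (sym_group n).
     p = id \<or> simple_group ((sym_group n) \<lparr> carrier := generate (sym_group n) {p} \<rparr>)}"

text \<open>Topological planarity: the vertices are distinct points of the plane and every edge is an
  arc joining its two ends, which meets the vertices and the other edges only in common ends.
  Drawing the unordered pairs \<open>{u, v}\<close> makes two opposite arcs of a symmetric digraph one edge.
  This is meant for graphs without loops and parallel edges.\<close>

definition undirected_edges :: "('a, 'b) pre_digraph \<Rightarrow> 'a set set" where
  "undirected_edges G = {{u, v} | u v. (u, v) \<in> arcs_ends G}"

definition plane_drawing ::
  "('a, 'b) pre_digraph \<Rightarrow> ('a \<Rightarrow> complex) \<Rightarrow> ('a set \<Rightarrow> real \<Rightarrow> complex) \<Rightarrow> bool" where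
  "plane_drawing G f g \<longleftrightarrow>
    inj_on f (verts G) \<and>
    (\<forall>e\<in>undirected_edges G.
      Path_Connected.arc (g e) \<and>
      {pathstart (g e), pathfinish (g e)} = f ` e \<and>
      path_image (g e) \<inter> f ` verts G = f ` e) \<and>
    (\<forall>e\<in>undirected_edges G. \<forall>e'\<in>undirected_edges G.
      e \<noteq> e' \<longrightarrow> path_image (g e) \<inter> path_image (g e') \<subseteq> f ` (e \<inter> e'))"

definition planar :: "('a, 'b) pre_digraph \<Rightarrow> bool" where
  "planar G \<longleftrightarrow> (\<exists>f g. plane_drawing G f g)"

end

theory Submission
  imports Defs "HOL-Complex_Analysis.Winding_Numbers" "HOL-Algebra.Multiplicative_Group"
begin

text \<open>
  \<^emph>\<open>Boolean permutations.\<close> Deleting the last letter of a Boolean canonical word leaves one, so every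
  vertex is joined to the identity. For \<open>n \<ge> 7\<close> the elements \<open>1, \<tau>\<^sub>2, \<tau>\<^sub>2\<tau>\<^sub>1\<close>, each multiplied by
  \<open>1, \<tau>\<^sub>4, \<tau>\<^sub>5, \<tau>\<^sub>6\<close>, span a claw times a path. This contains a subdivision of \<open>K\<^sub>3\<^sub>,\<^sub>3\<close> with parts
  \<open>{1, \<tau>\<^sub>2, \<tau>\<^sub>2\<tau>\<^sub>1}\<close> and \<open>{\<tau>\<^sub>2\<tau>\<^sub>4, \<tau>\<^sub>2\<tau>\<^sub>5, \<tau>\<^sub>2\<tau>\<^sub>6}\<close>. To see that \<open>K\<^sub>3\<^sub>,\<^sub>3\<close> has no plane drawing, regard two
  vertices of one part as the poles of a theta curve through the other part: every face of a theta curve misses one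
  of its three arcs, so the third vertex cannot lie in any face. For \<open>n = 6\<close> there is a straight-line
  drawing on the integer grid, which is checked by orientation tests, and smaller \<open>n\<close> give subgraphs.

  \<^emph>\<open>Cycles.\<close> Let \<open>p\<close> be an \<open>n\<close>-cycle in which \<open>i\<close> and \<open>i + 1\<close> are never consecutive. Then
  \<open>p\<tau>\<^sub>i\<close> splits into two nontrivial cycles for every \<open>i\<close>, so \<open>p\<close> is isolated. Such cycles exist for
  \<open>n \<ge> 5\<close>.

  \<^emph>\<open>Simple cyclic groups.\<close> For \<open>n \<ge> 4\<close> the involution exchanging \<open>j\<close> and \<open>j + n div 2\<close> is isolated:
  a product with \<open>\<tau>\<^sub>i\<close> contains a 4-cycle, or a 3-cycle together with a 2-cycle, and has composite order.
\<close>

subsection \<open>Theta curves\<close>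

definition theta_curve :: "complex \<Rightarrow> complex \<Rightarrow> (real \<Rightarrow> complex) \<Rightarrow> (real \<Rightarrow> complex) \<Rightarrow> (real \<Rightarrow> complex) \<Rightarrow> bool"
  where "theta_curve a b p q r \<longleftrightarrow>
    (\<forall>s\<in>{p, q, r}. Path_Connected.arc s \<and> pathstart s = a \<and> pathfinish s = b) \<and>
    path_image p \<inter> path_image q = {a, b} \<and> path_image q \<inter> path_image r = {a, b} \<and>
    path_image r \<inter> path_image p = {a, b}"

lemma theta_curve_rotate: "theta_curve a b p q r \<Longrightarrow> theta_curve a b q r p"
  by (auto simp: theta_curve_def)

lemma theta_curve_loop:
  assumes "theta_curve a b p q r"
  shows "simple_path (q +++ reversepath r)" "pathfinish (q +++ reversepath r) = pathstart (q +++ reversepath r)"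
    "path_image (q +++ reversepath r) = path_image q \<union> path_image r"
proof -
  show "simple_path (q +++ reversepath r)"
    using assms unfolding theta_curve_def
    by (intro simple_path_join_loop) (auto simp: arc_reversepath)
qed (use assms in \<open>auto simp: theta_curve_def path_image_join\<close>)

text \<open>\<open>inside C\<close> and \<open>outside C\<close> are disjoint open sets covering the
  complement of a closed \<open>C\<close>, so a connected set avoiding \<open>C\<close> cannot meet
  both.\<close>

lemma connected_subset_inside:
  fixes S C :: "complex set"
  assumes "Topological_Spaces.connected S" "closed C" "S \<inter> C = {}" "S \<inter> inside C \<noteq> {}"
  shows "S \<subseteq> inside C"
proof (rule ccontr)
  assume "\<not> S \<subseteq> inside C"
  with assms(3) have "S \<inter> outside C \<noteq> {}"
    using inside_Un_outside[of C] by blast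
  moreover have "open (inside C)" "open (outside C)"
    using assms(2) by (simp_all add: open_inside open_outside)
  moreover have "S \<subseteq> inside C \<union> outside C"
    using assms(3) inside_Un_outside[of C] by blast
  ultimately show False
    using connectedD[OF assms(1), of "inside C" "outside C"] assms(4) inside_Int_outside[of C] by blast
qed

text \<open>The arc without its ends is connected and avoids the loop formed by the other two, so it
  cannot change sides.\<close>

lemma theta_curve_cases:
  assumes "theta_curve a b p q r"
  shows "path_image p - {a, b} \<subseteq> inside (path_image q \<union> path_image r) \<or>
         path_image p \<inter> inside (path_image q \<union> path_image r) = {}"
proof (rule disjCI)
  let ?C = "path_image q \<union> path_image r"
  assume "path_image p \<inter> inside ?C \<noteq> {}"
  moreover have ab: "a \<in> ?C" "b \<in> ?C"
    using assms by (auto simp: theta_curve_def)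
  ultimately have meet: "(path_image p - {a, b}) \<inter> inside ?C \<noteq> {}"
    using inside_no_overlap[of ?C] by blast
  have *: "Path_Connected.arc p" "pathstart p = a" "pathfinish p = b"
    using assms by (auto simp: theta_curve_def)
  then have "Topological_Spaces.connected (path_image p - {a, b})"
    by (metis arc_imp_simple_path connected_simple_path_endless)
  moreover have "closed ?C"
    using assms by (auto simp: theta_curve_def closed_arc_image intro!: closed_Un)
  moreover have "(path_image p - {a, b}) \<inter> ?C = {}"
    using assms by (auto simp: theta_curve_def)
  ultimately show "path_image p - {a, b} \<subseteq> inside ?C"
    using meet connected_subset_inside by blast
qed

lemma theta_curve_interior_nonempty:
  assumes "theta_curve a b p q r"
  obtains w where "w \<in> path_image p" "w \<notin> {a, b}"
proof
  have "Path_Connected.arc p" "pathstart p = a" "pathfinish p = b" using assms by (auto simp: theta_curve_def)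
  then have "path_image p - {a, b} \<noteq> {}"
    using nonempty_simple_path_endless[OF arc_imp_simple_path] by auto
  then show "(SOME w. w \<in> path_image p - {a, b}) \<in> path_image p" "(SOME w. w \<in> path_image p - {a, b}) \<notin> {a, b}"
    using some_in_eq[of "path_image p - {a, b}"] by auto
qed

text \<open>If the two insides met, each being connected and avoiding the other loop, they would
  coincide. Then so would their frontiers, although the interior of \<open>q\<close> lies on only
  one of the two loops.\<close>

lemma theta_curve_insides_disjoint:
  assumes th: "theta_curve a b p q r"
    and p: "path_image p \<inter> inside (path_image q \<union> path_image r) = {}"
    and q: "path_image q \<inter> inside (path_image r \<union> path_image p) = {}"
  shows "inside (path_image q \<union> path_image r) \<inter> inside (path_image r \<union> path_image p) = {}"
proof (rule ccontr)
  let ?A = "path_image q \<union> path_image r" and ?B = "path_image r \<union> path_image p"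
  assume meet: "inside ?A \<inter> inside ?B \<noteq> {}"
  have closed: "closed ?A" "closed ?B"
    using th by (auto simp: theta_curve_def closed_arc_image intro!: closed_Un)
  note A = Jordan_inside_outside[OF theta_curve_loop(1,2)[OF th], unfolded theta_curve_loop(3)[OF th]]
  have th': "theta_curve a b q r p" by (rule theta_curve_rotate[OF th])
  note B = Jordan_inside_outside[OF theta_curve_loop(1,2)[OF th'], unfolded theta_curve_loop(3)[OF th']]
  have "inside ?A \<inter> ?B = {}" "inside ?B \<inter> ?A = {}"
    using p q inside_no_overlap[of ?A] inside_no_overlap[of ?B] by blast+
  then have "inside ?A = inside ?B"
    using A B closed meet
      connected_subset_inside[of "inside ?A" ?B] connected_subset_inside[of "inside ?B" ?A] by blast
  then have "?A = ?B" using A B by metis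
  moreover obtain w where "w \<in> path_image q" "w \<notin> {a, b}"
    using theta_curve_interior_nonempty[OF th'] .
  ultimately show False using th unfolding theta_curve_def by blast
qed

lemma winding_number_join_reversepath:
  assumes "path q" "path r" "pathstart q = pathstart r" "pathfinish q = pathfinish r"
    "z \<notin> path_image q" "z \<notin> path_image r"
  shows "winding_number (q +++ reversepath r) z = winding_number q z - winding_number r z"
  using assms by (simp add: winding_number_join winding_number_reversepath)

text \<open>Some arc must run inside the loop of the other two. Otherwise the three insides are
  pairwise disjoint, and a point of one of them lies outside the other two loops.\<close>

lemma theta_curve_some_inside:
  assumes th: "theta_curve a b p q r"
    and p: "path_image p \<inter> inside (path_image q \<union> path_image r) = {}"
    and q: "path_image q \<inter> inside (path_image r \<union> path_image p) = {}"
    and r: "path_image r \<inter> inside (path_image p \<union> path_image q) = {}"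
  shows False
proof -
  note th2 = theta_curve_rotate[OF th]
  note th3 = theta_curve_rotate[OF th2]
  obtain z where z: "z \<in> inside (path_image q \<union> path_image r)"
    using Jordan_inside_outside[OF theta_curve_loop(1,2)[OF th], unfolded theta_curve_loop(3)[OF th]] by blast
  have zn: "z \<notin> path_image p" "z \<notin> path_image q" "z \<notin> path_image r"
    using z p inside_no_overlap[of "path_image q \<union> path_image r"] by blast+
  have "z \<notin> inside (path_image r \<union> path_image p)"
    using theta_curve_insides_disjoint[OF th p q] z by blast
  moreover have "z \<notin> inside (path_image p \<union> path_image q)"
    using theta_curve_insides_disjoint[OF th3 r p] z by blast
  ultimately have out: "z \<in> outside (path_image r \<union> path_image p)" "z \<in> outside (path_image p \<union> path_image q)"
    using zn inside_Un_outside by blast+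
  have paths: "path p" "path q" "path r" "pathstart p = a" "pathstart q = a" "pathstart r = a"
     "pathfinish p = b" "pathfinish q = b" "pathfinish r = b"
    using th by (auto simp: theta_curve_def arc_imp_path)
  \<comment> \<open>The winding numbers of the three loops add up to zero, so they cannot single out one inside.\<close>
  have "winding_number (r +++ reversepath p) z = 0" "winding_number (p +++ reversepath q) z = 0"
    using out paths theta_curve_loop(3)[OF th2] theta_curve_loop(3)[OF th3]
    by (auto intro!: winding_number_zero_in_outside)
  moreover have "winding_number (q +++ reversepath r) z \<noteq> 0"
    using simple_closed_path_norm_winding_number_inside[OF theta_curve_loop(1)[OF th], of z] z
      theta_curve_loop(3)[OF th] by auto
  ultimately show False
    using paths zn by (simp add: winding_number_join_reversepath)
qed

text \<open>The equivalences put \<open>c\<close> on the same side of each loop as the remaining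
  arc. If \<open>p\<close> is an arc inside the loop of the others, it cuts that inside into two
  regions, and \<open>c\<close> lies in one of them. The boundary of this region omits
  \<open>q\<close> or \<open>r\<close>, and the omitted arc would have to enter the region although
  it lies on the outer loop.\<close>

lemma theta_curve_face_misses_arc:
  assumes th: "theta_curve a b p q r" and c: "c \<notin> path_image p \<union> path_image q \<union> path_image r"
    and p: "c \<in> inside (path_image q \<union> path_image r) \<longleftrightarrow> path_image p - {a, b} \<subseteq> inside (path_image q \<union> path_image r)"
    and q: "c \<in> inside (path_image r \<union> path_image p) \<longleftrightarrow> path_image q - {a, b} \<subseteq> inside (path_image r \<union> path_image p)"
    and r: "c \<in> inside (path_image p \<union> path_image q) \<longleftrightarrow> path_image r - {a, b} \<subseteq> inside (path_image p \<union> path_image q)"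
  shows False
proof -
  \<comment> \<open>The arc inside the loop of the other two is called \<open>p\<close> here; the
    remaining cases follow by rotating the theta curve.\<close>
  have main: False
    if th: "theta_curve a b p q r" and c: "c \<notin> path_image p \<union> path_image q \<union> path_image r"
      and cp: "c \<in> inside (path_image q \<union> path_image r)"
      and p: "path_image p - {a, b} \<subseteq> inside (path_image q \<union> path_image r)"
      and q: "c \<in> inside (path_image r \<union> path_image p) \<longleftrightarrow> path_image q - {a, b} \<subseteq> inside (path_image r \<union> path_image p)"
      and r: "c \<in> inside (path_image p \<union> path_image q) \<longleftrightarrow> path_image r - {a, b} \<subseteq> inside (path_image p \<union> path_image q)"
    for p q r
  proof -
    note th2 = theta_curve_rotate[OF th]
    note th3 = theta_curve_rotate[OF th2]
    have sp: "simple_path p" "simple_path q" "simple_path r" and ab: "a \<noteq> b"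
      and ends: "pathstart p = a" "pathstart q = a" "pathstart r = a"
        "pathfinish p = b" "pathfinish q = b" "pathfinish r = b"
      using th by (auto simp: theta_curve_def arc_imp_simple_path dest: arc_distinct_ends)
    obtain w where "w \<in> path_image p" "w \<notin> {a, b}" using theta_curve_interior_nonempty[OF th] .
    then have meet: "path_image p \<inter> inside (path_image q \<union> path_image r) \<noteq> {}" using p by blast
    have int: "path_image q \<inter> path_image r = {a, b}" "path_image q \<inter> path_image p = {a, b}"
      "path_image r \<inter> path_image p = {a, b}" using th by (auto simp: theta_curve_def)
    have split: "inside (path_image q \<union> path_image p) \<union> inside (path_image r \<union> path_image p)
          \<union> (path_image p - {a, b}) = inside (path_image q \<union> path_image r)"
      by (rule split_inside_simple_closed_curve[OF sp(2) ends(2,5) sp(3) ends(3,6) sp(1) ends(1,4) ab int meet])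
    obtain u where u: "u \<in> path_image q" "u \<notin> {a, b}" using theta_curve_interior_nonempty[OF th2] .
    obtain v where v: "v \<in> path_image r" "v \<notin> {a, b}" using theta_curve_interior_nonempty[OF th3] .
    have "u \<notin> inside (path_image q \<union> path_image r)" "v \<notin> inside (path_image q \<union> path_image r)"
      using u v inside_no_overlap[of "path_image q \<union> path_image r"] by blast+
    moreover have "c \<in> inside (path_image p \<union> path_image q) \<or> c \<in> inside (path_image r \<union> path_image p)"
      using split cp c by (auto simp: Un_commute)
    ultimately show False
      using q r u v split by (auto simp: Un_commute)
  qed
  note th2 = theta_curve_rotate[OF th]
  note th3 = theta_curve_rotate[OF th2]
  consider "path_image p - {a, b} \<subseteq> inside (path_image q \<union> path_image r)"
    | "path_image q - {a, b} \<subseteq> inside (path_image r \<union> path_image p)"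
    | "path_image r - {a, b} \<subseteq> inside (path_image p \<union> path_image q)"
    using theta_curve_some_inside[OF th] theta_curve_cases[OF th] theta_curve_cases[OF th2]
      theta_curve_cases[OF th3] by blast
  then show False
  proof cases
    case 1
    then show False using main[OF th c] p q r by blast
  next
    case 2
    then show False using main[OF th2 _ _ _ r p] c q by blast
  next
    case 3
    then show False using main[OF th3 _ _ _ p q] c r by blast
  qed
qed

text \<open>\<open>S\<close> keeps \<open>c\<close> and \<open>x\<close> on one side of the loop,
  and the open arc \<open>p\<close> is on the side of its point \<open>x\<close>. This supplies the
  hypotheses of \<open>theta_curve_face_misses_arc\<close> when \<open>S\<close> is an edge starting
  at \<open>c\<close>.\<close>

lemma theta_curve_same_side:
  assumes th: "theta_curve a b p q r" and "Topological_Spaces.connected S" "c \<in> S" "x \<in> S" "x \<in> path_image p" "x \<notin> {a, b}"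
    "S \<inter> (path_image q \<union> path_image r) = {}"
  shows "c \<in> inside (path_image q \<union> path_image r) \<longleftrightarrow> path_image p - {a, b} \<subseteq> inside (path_image q \<union> path_image r)"
proof -
  have "closed (path_image q \<union> path_image r)"
    using th by (auto simp: theta_curve_def closed_arc_image intro!: closed_Un)
  then have "c \<in> inside (path_image q \<union> path_image r) \<longleftrightarrow> x \<in> inside (path_image q \<union> path_image r)"
    using connected_subset_inside[of S] assms by blast
  then show ?thesis using theta_curve_cases[OF th] assms by blast
qed

text \<open>The poles are \<open>A 0\<close> and \<open>A 1\<close>, and \<open>p j\<close> is the
  arc between them through \<open>B j\<close>. The arc \<open>g 2 j\<close> joins \<open>A 2\<close>
  to \<open>B j\<close> and avoids the other two, so \<open>A 2\<close> would be on the side of all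
  three arcs.\<close>

theorem K33_not_plane:
  fixes A B :: "nat \<Rightarrow> complex" and g :: "nat \<Rightarrow> nat \<Rightarrow> real \<Rightarrow> complex"
  assumes arc: "\<And>i j. i < 3 \<Longrightarrow> j < 3 \<Longrightarrow> Path_Connected.arc (g i j)"
    and ends: "\<And>i j. i < 3 \<Longrightarrow> j < 3 \<Longrightarrow> pathstart (g i j) = A i \<and> pathfinish (g i j) = B j"
    and meet: "\<And>i j i' j'. i < 3 \<Longrightarrow> j < 3 \<Longrightarrow> i' < 3 \<Longrightarrow> j' < 3 \<Longrightarrow> (i, j) \<noteq> (i', j') \<Longrightarrow>
      path_image (g i j) \<inter> path_image (g i' j') \<subseteq> (if i = i' then {A i} else if j = j' then {B j} else {})"
  shows False
proof -
  have A: "A i \<in> path_image (g i j)" and B: "B j \<in> path_image (g i j)" if "i < 3" "j < 3" for i j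
    using ends[OF that] by (metis pathstart_in_path_image pathfinish_in_path_image)+
  have meetD: "i = i' \<and> w = A i \<or> j = j' \<and> w = B j"
    if "w \<in> path_image (g i j)" "w \<in> path_image (g i' j')" "i < 3" "j < 3" "i' < 3" "j' < 3" "(i, j) \<noteq> (i', j')"
    for w i j i' j'
    using meet[of i j i' j'] that by (auto split: if_splits)
  have AB: "A i \<noteq> B j" if "i < 3" "j < 3" for i j
    using arc_distinct_ends[OF arc[OF that]] ends[OF that] by simp
  \<comment> \<open>The index other than \<open>j\<close> selects an arc at \<open>A i\<close> that
    has neither index in common with \<open>g i' j\<close>; by \<open>meet\<close> the two are
    disjoint.\<close>
  have Aj: "A i \<notin> path_image (g i' j)" if "i < 3" "i' < 3" "j < 3" "i \<noteq> i'" for i i' j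
    using meetD[OF A[of i "if j = 0 then 1 else 0"], of i' j] that by (auto split: if_splits)
  have Bi: "B j \<notin> path_image (g i j')" if "i < 3" "j < 3" "j' < 3" "j \<noteq> j'" for i j j'
    using meetD[OF B[of "if i = 0 then 1 else 0" j], of i j'] that by (auto split: if_splits)
  define p where "p j = g 0 j +++ reversepath (g 1 j)" for j
  have p: "Path_Connected.arc (p j)" "pathstart (p j) = A 0" "pathfinish (p j) = A 1"
    "path_image (p j) = path_image (g 0 j) \<union> path_image (g 1 j)" if "j < 3" for j
  proof -
    have "path_image (g 0 j) \<inter> path_image (g 1 j) \<subseteq> {B j}"
      using meet[of 0 j 1 j] that by simp
    then show "Path_Connected.arc (p j)"
      unfolding p_def using that by (intro arc_join) (auto simp: arc arc_reversepath ends)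
  qed (use that in \<open>auto simp: p_def ends path_image_join\<close>)
  have pp: "path_image (p j) \<inter> path_image (p j') = {A 0, A 1}" if jj: "j < 3" "j' < 3" "j \<noteq> j'" for j j'
  proof
    show "path_image (p j) \<inter> path_image (p j') \<subseteq> {A 0, A 1}"
    proof
      fix w assume w: "w \<in> path_image (p j) \<inter> path_image (p j')"
      obtain i where i: "i < 2" "w \<in> path_image (g i j)"
        using w p(4)[OF jj(1)] by (metis IntD1 Un_iff one_less_numeral_iff pos2 semiring_norm(76))
      obtain i' where i': "i' < 2" "w \<in> path_image (g i' j')"
        using w p(4)[OF jj(2)] by (metis IntD2 Un_iff one_less_numeral_iff pos2 semiring_norm(76))
      have "w = A i"
        using meetD[OF i(2) i'(2)] i i' jj by simp
      with i show "w \<in> {A 0, A 1}"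
        by (auto simp: less_2_cases_iff)
    qed
  qed (use that p(4) A in auto)
  have th: "theta_curve (A 0) (A 1) (p 0) (p 1) (p 2)"
    unfolding theta_curve_def using p(1-3) pp[of 0 1] pp[of 1 2] pp[of 2 0] by simp
  note th2 = theta_curve_rotate[OF th]
  note th3 = theta_curve_rotate[OF th2]
  have con: "Topological_Spaces.connected (path_image (g 2 j))" if "j < 3" for j
    using arc[of 2 j] that by (simp add: arc_imp_path connected_path_image)
  have dis: "path_image (g 2 j) \<inter> path_image (p j') = {}" if "j < 3" "j' < 3" "j \<noteq> j'" for j j'
    using p(4)[OF that(2)] meetD[of _ 2 j 0 j'] meetD[of _ 2 j 1 j'] that by auto
  have side: "A 2 \<in> path_image (g 2 j)" "B j \<in> path_image (g 2 j)" "B j \<in> path_image (p j)" "B j \<notin> {A 0, A 1}"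
    if "j < 3" for j
    using that A B p(4) AB[of 0 j] AB[of 1 j] by auto
  show False
  proof (rule theta_curve_face_misses_arc[OF th])
    show "A 2 \<notin> path_image (p 0) \<union> path_image (p 1) \<union> path_image (p 2)"
      using Aj p(4) by simp
  qed (intro theta_curve_same_side[OF th _ side(1) side(2,3,4)] theta_curve_same_side[OF th2 _ side(1) side(2,3,4)]
        theta_curve_same_side[OF th3 _ side(1) side(2,3,4)] con; simp add: dis Int_Un_distrib)+
qed

subsection \<open>The graph of a set of permutations\<close>

lemma verts_Gamma_graph [simp]: "verts (Gamma_graph n A) = A"
  by (simp add: Gamma_graph_def)

lemma arcs_ends_Gamma_graph:
  assumes "A \<subseteq> carrier (sym_group n)"
  shows "arcs_ends (Gamma_graph n A) = {(p, q). p \<in> A \<and> q \<in> A \<and> (\<exists>i\<in>{1..n - 1}. q = p \<circ> tau i)}"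
  using assms
  by (auto simp: Gamma_graph_def arcs_ends_conv cayley_graph_def sym_group_def image_iff)

lemma bS_subset: "bS n \<subseteq> carrier (sym_group n)"
  by (auto simp: bS_def)

subsection \<open>Drawings with straight edges\<close>

text \<open>The drawing of \<open>G\<close> is kept. By \<open>wf\<close> the ends of an edge of
  \<open>H\<close> are vertices of \<open>H\<close>, so the condition on the vertices met by an edge
  restricts to them.\<close>

lemma planar_mono:
  assumes "planar G" and "verts H \<subseteq> verts G" and "arcs_ends H \<subseteq> arcs_ends G"
    and wf: "\<And>u v. (u, v) \<in> arcs_ends H \<Longrightarrow> u \<in> verts H \<and> v \<in> verts H"
  shows "planar H"
proof -
  obtain f g where fg: "plane_drawing G f g" using assms(1) by (auto simp: planar_def)
  have edges: "undirected_edges H \<subseteq> undirected_edges G"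
    using assms(3) by (auto simp: undirected_edges_def)
  have "path_image (g e) \<inter> f ` verts H = f ` e" if e: "e \<in> undirected_edges H" for e
  proof -
    have "e \<subseteq> verts H" using e wf by (auto simp: undirected_edges_def)
    moreover have "path_image (g e) \<inter> f ` verts G = f ` e"
      using fg edges e unfolding plane_drawing_def by (meson subsetD)
    ultimately show ?thesis using assms(2) by blast
  qed
  then have "plane_drawing H f g"
    using fg assms(2) edges unfolding plane_drawing_def by (meson inj_on_subset subsetD)
  then show ?thesis by (auto simp: planar_def)
qed

section \<open>Orientation tests for segments on the integer grid\<close>

type_synonym grid_point = "int \<times> int"

text \<open>Twice the signed area of the triangle, so its sign is the orientation of the three
  points. Integer coordinates make the tests exact and executable.\<close>

fun cross :: "grid_point \<Rightarrow> grid_point \<Rightarrow> grid_point \<Rightarrow> int" where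
  "cross (x0, y0) (x1, y1) (x2, y2) = (x1 - x0) * (y2 - y0) - (y1 - y0) * (x2 - x0)"

definition same_side :: "grid_point \<Rightarrow> grid_point \<Rightarrow> grid_point \<Rightarrow> grid_point \<Rightarrow> bool" where
  "same_side a b c d \<longleftrightarrow> 0 < cross a b c * cross a b d"

text \<open>A sufficient test, meant for different edges. Segments with a common end must not be
  collinear; of two segments without one, either must lie strictly on one side of the line through
  the other. Disjoint collinear segments are rejected.\<close>

fun segments_ok :: "grid_point \<times> grid_point \<Rightarrow> grid_point \<times> grid_point \<Rightarrow> bool" where
  "segments_ok (a, b) (c, d) =
    (if a = c then cross a b d \<noteq> 0 else if a = d then cross a b c \<noteq> 0
     else if b = c then cross b a d \<noteq> 0 else if b = d then cross b a c \<noteq> 0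
     else same_side a b c d \<or> same_side c d a b)"

definition to_complex :: "grid_point \<Rightarrow> complex" where
  "to_complex p = Complex (of_int (fst p)) (of_int (snd p))"

lemma inj_to_complex: "inj to_complex"
  by (auto simp: inj_def to_complex_def prod_eq_iff)

definition segment :: "grid_point \<times> grid_point \<Rightarrow> complex set" where
  "segment e = closed_segment (to_complex (fst e)) (to_complex (snd e))"

definition ccross :: "complex \<Rightarrow> complex \<Rightarrow> complex \<Rightarrow> real" where
  "ccross a b z = (Re b - Re a) * (Im z - Im a) - (Im b - Im a) * (Re z - Re a)"

lemma of_int_cross: "of_int (cross a b c) = ccross (to_complex a) (to_complex b) (to_complex c)"
  by (cases a; cases b; cases c) (simp add: ccross_def to_complex_def)

lemma ccross_affine:
  "ccross a b ((1 - u) *\<^sub>R c + u *\<^sub>R d) = (1 - u) * ccross a b c + u * ccross a b d"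
  by (simp add: ccross_def algebra_simps)

lemma ccross_ends [simp]: "ccross a b a = 0" "ccross a b b = 0"
  by (simp_all add: ccross_def)

lemma ccross_closed_segment: "z \<in> closed_segment a b \<Longrightarrow> ccross a b z = 0"
  by (auto simp: in_segment ccross_affine)

text \<open>\<open>ccross\<close> of \<open>a\<close> and \<open>b\<close> is affine in its last
  argument, vanishes on the first segment and has the same strict sign at both ends of the second,
  hence all along it.\<close>

lemma same_side_disjoint:
  assumes "same_side a b c d"
  shows "segment (a, b) \<inter> segment (c, d) = {}"
proof (rule ccontr)
  let ?c = "ccross (to_complex a) (to_complex b) (to_complex c)" and ?d = "ccross (to_complex a) (to_complex b) (to_complex d)"
  assume "segment (a, b) \<inter> segment (c, d) \<noteq> {}"
  then obtain z where z: "z \<in> closed_segment (to_complex a) (to_complex b)" "z \<in> closed_segment (to_complex c) (to_complex d)"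
    by (auto simp: segment_def)
  then obtain u where u: "0 \<le> u" "u \<le> 1" "(1 - u) * ?c + u * ?d = 0"
    using ccross_closed_segment[OF z(1)] by (auto simp: in_segment ccross_affine)
  have "of_int (cross a b c * cross a b d) = ?c * ?d" by (simp add: of_int_cross)
  then have "0 < ?c * ?d" using assms by (metis of_int_0_less_iff same_side_def)
  then consider "0 < ?c" "0 < ?d" | "?c < 0" "?d < 0" by (auto simp: zero_less_mult_iff)
  then show False
  proof cases
    case 1
    then have "0 < (1 - u) * ?c + u * ?d" using u
      by (metis add_nonneg_pos add_pos_nonneg diff_ge_0_iff_ge less_eq_real_def mult_nonneg_nonneg mult_pos_pos
          diff_zero mult_1 zero_less_one)
    then show False using u by simp
  next
    case 2
    then have "0 < (1 - u) * (- ?c) + u * (- ?d)" using u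
      by (metis add_nonneg_pos add_pos_nonneg diff_ge_0_iff_ge less_eq_real_def mult_nonneg_nonneg mult_pos_pos
          diff_zero mult_1 zero_less_one neg_0_less_iff_less)
    then show False using u by simp
  qed
qed

lemma segment_commute: "segment (a, b) = segment (b, a)"
  by (simp add: segment_def closed_segment_commute)

text \<open>Along the segment from \<open>a\<close> to \<open>c\<close> the value of
  \<open>ccross\<close> is \<open>u\<close> times its nonzero value at \<open>c\<close>, so it
  vanishes only at \<open>u = 0\<close>.\<close>

lemma cross_segment_Int:
  assumes "cross a b c \<noteq> 0"
  shows "segment (a, b) \<inter> segment (a, c) \<subseteq> {to_complex a}"
proof
  fix z assume "z \<in> segment (a, b) \<inter> segment (a, c)"
  then have z: "z \<in> closed_segment (to_complex a) (to_complex b)" "z \<in> closed_segment (to_complex a) (to_complex c)"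
    by (auto simp: segment_def)
  then obtain u where u: "z = (1 - u) *\<^sub>R to_complex a + u *\<^sub>R to_complex c"
    by (auto simp: in_segment)
  have "u * ccross (to_complex a) (to_complex b) (to_complex c) = 0"
    using ccross_closed_segment[OF z(1)] by (simp add: u ccross_affine)
  then have "u = 0" using assms by (metis mult_eq_0_iff of_int_cross of_int_eq_0_iff)
  then show "z \<in> {to_complex a}" by (simp add: u)
qed

lemma segments_ok_Int:
  assumes "segments_ok e e'"
  shows "segment e \<inter> segment e' \<subseteq> to_complex ` ({fst e, snd e} \<inter> {fst e', snd e'})"
proof -
  obtain a b c d where e: "e = (a, b)" "e' = (c, d)" by (metis surj_pair)
  show ?thesis
    using assms cross_segment_Int[of a b d] cross_segment_Int[of a b c] cross_segment_Int[of b a d]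
      cross_segment_Int[of b a c] same_side_disjoint[of a b c d] same_side_disjoint[of c d a b]
    unfolding e by (auto simp: segment_commute split: if_splits)
qed

text \<open>Tests between segments are enough: by \<open>cover\<close> every vertex is an end of a
  listed segment, so an edge running through a foreign vertex would violate one of them. Testing
  each pair in list order suffices because the resulting statement on intersections is
  symmetric.\<close>

lemma planar_straight_line:
  fixes h :: "'a \<Rightarrow> grid_point"
  assumes inj: "inj_on h (verts G)"
    and ok: "sorted_wrt segments_ok S"
    and ends: "\<And>a b. (a, b) \<in> set S \<Longrightarrow> a \<noteq> b"
    and edge: "\<And>u v. (u, v) \<in> arcs_ends G \<Longrightarrow>
      u \<in> verts G \<and> v \<in> verts G \<and> ((h u, h v) \<in> set S \<or> (h v, h u) \<in> set S)"
    and cover: "\<And>u. u \<in> verts G \<Longrightarrow> \<exists>(a, b)\<in>set S. h u = a \<or> h u = b"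
  shows "planar G"
proof -
  have meet: "segment e \<inter> segment e' \<subseteq> to_complex ` ({fst e, snd e} \<inter> {fst e', snd e'})"
    if e: "e \<in> set S" "e' \<in> set S" "e \<noteq> e'" for e e'
  proof -
    have "segments_ok e e' \<or> segments_ok e' e"
      using ok e unfolding sorted_wrt_iff_nth_less by (metis in_set_conv_nth nat_neq_iff)
    then show ?thesis using segments_ok_Int[of e e'] segments_ok_Int[of e' e] by blast
  qed
  \<comment> \<open>An edge may be listed in either orientation; \<open>s E\<close> picks one that
    occurs in \<open>S\<close>.\<close>
  define s where "s E = (SOME e. e \<in> set S \<and> {fst e, snd e} = h ` E)" for E
  have s: "s E \<in> set S" "{fst (s E), snd (s E)} = h ` E" "E \<subseteq> verts G" if E: "E \<in> undirected_edges G" for E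
  proof -
    obtain u v where uv: "E = {u, v}" "(u, v) \<in> arcs_ends G" using E by (auto simp: undirected_edges_def)
    then have "\<exists>e. e \<in> set S \<and> {fst e, snd e} = h ` E"
      using edge[OF uv(2)] unfolding uv(1)
      by (elim conjE disjE) (intro exI[of _ "(h u, h v)"] exI[of _ "(h v, h u)"] conjI; auto; fail)+
    then have "s E \<in> set S \<and> {fst (s E), snd (s E)} = h ` E" unfolding s_def by (rule someI_ex)
    then show "s E \<in> set S" "{fst (s E), snd (s E)} = h ` E" by blast+
    show "E \<subseteq> verts G" using uv edge by blast
  qed
  let ?f = "to_complex \<circ> h" and ?g = "\<lambda>E. linepath (to_complex (fst (s E))) (to_complex (snd (s E)))"
  have f: "inj_on ?f (verts G)" using inj inj_to_complex by (simp add: comp_inj_on inj_on_subset)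
  have img: "path_image (?g E) = segment (s E)" for E by (simp add: segment_def)
  have sub: "segment (s E) \<inter> segment (s E') \<subseteq> ?f ` (E \<inter> E')"
    if E: "E \<in> undirected_edges G" "E' \<in> undirected_edges G" "E \<noteq> E'" for E E'
  proof -
    have "h ` E \<noteq> h ` E'" using E s(3) inj by (metis inj_on_image_eq_iff)
    then have "s E \<noteq> s E'" using s(2) E by metis
    then have "segment (s E) \<inter> segment (s E') \<subseteq> to_complex ` (h ` E \<inter> h ` E')"
      using meet[of "s E" "s E'"] s E by metis
    also have "h ` E \<inter> h ` E' = h ` (E \<inter> E')"
      using inj s(3) E by (metis inj_on_image_Int)
    finally show ?thesis by (simp add: image_comp)
  qed
  have vertex: "segment (s E) \<inter> ?f ` verts G = ?f ` E" if E: "E \<in> undirected_edges G" for E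
  proof
    show "segment (s E) \<inter> ?f ` verts G \<subseteq> ?f ` E"
    proof
      fix z assume "z \<in> segment (s E) \<inter> ?f ` verts G"
      then obtain w where w: "w \<in> verts G" "z = to_complex (h w)" "z \<in> segment (s E)" by auto
      obtain e where e: "e \<in> set S" "h w \<in> {fst e, snd e}" using cover[OF w(1)] by force
      then have "z \<in> segment e" using w by (auto simp: segment_def)
      then have "z \<in> to_complex ` {fst (s E), snd (s E)}"
        using meet[OF s(1)[OF E] e(1)] w e(2) by (cases "e = s E") auto
      then show "z \<in> ?f ` E" by (simp only: s(2)[OF E] image_comp)
    qed
    show "?f ` E \<subseteq> segment (s E) \<inter> ?f ` verts G"
    proof
      fix z assume z: "z \<in> ?f ` E"
      then have "z \<in> to_complex ` {fst (s E), snd (s E)}" by (simp only: s(2)[OF E] image_comp)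
      then have "z \<in> segment (s E)" by (auto simp: segment_def)
      with z s(3)[OF E] show "z \<in> segment (s E) \<inter> ?f ` verts G" by blast
    qed
  qed
  have "fst (s E) \<noteq> snd (s E)" if "E \<in> undirected_edges G" for E
    using ends[of "fst (s E)" "snd (s E)"] s(1)[OF that] by simp
  then have "Path_Connected.arc (?g E)" if "E \<in> undirected_edges G" for E
    using that inj_to_complex by (simp add: inj_eq)
  moreover have "{pathstart (?g E), pathfinish (?g E)} = ?f ` E" if "E \<in> undirected_edges G" for E
    by (simp only: image_comp[symmetric] s(2)[OF that, symmetric] pathstart_linepath pathfinish_linepath
        image_insert image_empty)
  ultimately have "plane_drawing G ?f ?g"
    unfolding plane_drawing_def img using f vertex sub by blast
  then show ?thesis unfolding planar_def by blast
qed

subsection \<open>Enumeration of Boolean permutations\<close>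

definition one_line :: "nat \<Rightarrow> (nat \<Rightarrow> nat) \<Rightarrow> nat list" where
  "one_line n p = map p [1..<Suc n]"

fun swap_adjacent :: "nat \<Rightarrow> 'a list \<Rightarrow> 'a list" where
  "swap_adjacent 0 (x # y # xs) = y # x # xs"
| "swap_adjacent (Suc i) (x # xs) = x # swap_adjacent i xs"
| "swap_adjacent _ xs = xs"

lemma length_swap_adjacent [simp]: "length (swap_adjacent i xs) = length xs"
  by (induction i xs rule: swap_adjacent.induct) auto

lemma nth_swap_adjacent:
  "Suc i < length xs \<Longrightarrow> k < length xs \<Longrightarrow>
    swap_adjacent i xs ! k = xs ! Transposition.transpose i (Suc i) k"
proof (induction i xs arbitrary: k rule: swap_adjacent.induct)
  case (1 x y xs)
  then show ?case by (cases k; cases "k - 1") (auto simp: Transposition.transpose_def)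
next
  case (2 i x xs)
  then show ?case by (cases k) (auto simp: Transposition.transpose_def)
qed auto

text \<open>In \<open>p \<circ> tau i\<close> the transposition acts on the argument, so it
  exchanges positions rather than values. Positions count from 0 while points count from 1, hence
  \<open>i - 1\<close>.\<close>

lemma one_line_tau:
  assumes "i \<in> {1..n - 1}"
  shows "one_line n (p \<circ> tau i) = swap_adjacent (i - 1) (one_line n p)"
proof (rule nth_equalityI)
  fix k assume "k < length (one_line n (p \<circ> tau i))"
  then have "k < n" by (simp add: one_line_def del: upt_Suc)
  then show "one_line n (p \<circ> tau i) ! k = swap_adjacent (i - 1) (one_line n p) ! k"
    using assms nth_swap_adjacent[of "i - 1" "one_line n p" k]
    by (auto simp: one_line_def tau_def Transposition.transpose_def simp del: upt_Suc)
qed (simp add: one_line_def del: upt_Suc)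

lemma one_line_inj:
  assumes "p permutes {1..n}" "q permutes {1..n}" "one_line n p = one_line n q"
  shows "p = q"
proof
  fix x
  show "p x = q x"
  proof (cases "x \<in> {1..n}")
    case True
    then show ?thesis using assms(3) by (auto simp: one_line_def)
  qed (use assms(1,2) in \<open>simp add: permutes_not_in\<close>)
qed

section \<open>Canonical words without repeated letters\<close>

abbreviation syllables_word :: "(nat \<times> nat) list \<Rightarrow> nat list" where
  "syllables_word kjs \<equiv> concat (map (\<lambda>(k, j). D_word k j) kjs)"

text \<open>The argument bounds the leading letters of the syllables. These increase along a
  canonical word, so a syllable starting with the new bound can only be appended at the end.
  Filtering at every level loses nothing, because a prefix of a word without repetitions has
  none.\<close>

fun boolean_syllables :: "nat \<Rightarrow> (nat \<times> nat) list list" where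
  "boolean_syllables 0 = [[]]"
| "boolean_syllables (Suc k) = boolean_syllables k @ filter (\<lambda>kjs. distinct (syllables_word kjs))
     (concat (map (\<lambda>kjs. map (\<lambda>j. kjs @ [(Suc k, j)]) [1..<Suc (Suc k)]) (boolean_syllables k)))"

lemma boolean_syllables_complete:
  assumes "sorted_wrt (<) (map fst kjs)" "\<forall>(k, j)\<in>set kjs. 1 \<le> j \<and> j \<le> k \<and> k \<le> m"
    "distinct (syllables_word kjs)"
  shows "kjs \<in> set (boolean_syllables m)"
  using assms
proof (induction m arbitrary: kjs)
  case 0
  then have "kjs = []" by (cases kjs) auto
  then show ?case by simp
next
  case (Suc m)
  show ?case
  proof (cases "\<forall>(k, j)\<in>set kjs. k \<le> m")
    case True
    then have "kjs \<in> set (boolean_syllables m)" using Suc by (intro Suc.IH) auto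
    then show ?thesis by simp
  next
    case False
    have bound: "1 \<le> j \<and> j \<le> k \<and> k \<le> Suc m" if "(k, j) \<in> set kjs" for k j
      using Suc.prems(2) that by auto
    obtain k j where kj: "(k, j) \<in> set kjs" "\<not> k \<le> m" using False by auto
    then obtain w k' j' where w: "kjs = w @ [(k', j')]" by (cases kjs rule: rev_cases) auto
    have less: "fst x < k'" if "x \<in> set w" for x
      using Suc.prems(1) that by (auto simp: w sorted_wrt_append)
    have k': "k' = Suc m"
      using kj less[of "(k, j)"] bound[of k' j'] bound[OF kj(1)] by (auto simp: w)
    have "w \<in> set (boolean_syllables m)"
    proof (rule Suc.IH)
      show "\<forall>(k, j)\<in>set w. 1 \<le> j \<and> j \<le> k \<and> k \<le> m"
        using bound less by (fastforce simp: w k')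
    qed (use Suc.prems(1,3) in \<open>auto simp: w sorted_wrt_append\<close>)
    moreover have "j' \<in> set [1..<Suc (Suc m)]" using bound[of k' j'] by (auto simp: w k')
    ultimately have "w @ [(Suc m, j')] \<in> (\<Union>kjs\<in>set (boolean_syllables m).
        (\<lambda>j. kjs @ [(Suc m, j)]) ` set [1..<Suc (Suc m)])"
      by blast
    then have "w @ [(Suc m, j')] \<in> set (concat (map (\<lambda>kjs. map (\<lambda>j. kjs @ [(Suc m, j)])
        [1..<Suc (Suc m)]) (boolean_syllables m)))"
      by (simp only: set_concat set_map image_image)
    then show ?thesis using Suc.prems(3) 
      by (simp only: boolean_syllables.simps set_append set_filter w k') blast
  qed
qed

definition boolean_one_lines :: "nat \<Rightarrow> nat list list" where
  "boolean_one_lines n = map (\<lambda>kjs. one_line n (word_perm (syllables_word kjs))) (boolean_syllables (n - 1))"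

lemma one_line_bS:
  assumes "p \<in> bS n" shows "one_line n p \<in> set (boolean_one_lines n)"
proof -
  obtain kjs where "sorted_wrt (<) (map fst kjs)" "\<forall>(k, j)\<in>set kjs. 1 \<le> j \<and> j \<le> k \<and> k \<le> n - 1"
    "distinct (syllables_word kjs)" "p = word_perm (syllables_word kjs)"
    using assms by (auto simp: bS_def canonical_word_def)
  then show ?thesis using boolean_syllables_complete[of kjs "n - 1"] by (auto simp: boolean_one_lines_def)
qed

section \<open>Executable check of a drawing\<close>

definition lexless :: "grid_point \<Rightarrow> grid_point \<Rightarrow> bool" where
  "lexless a b \<longleftrightarrow> fst a < fst b \<or> fst a = fst b \<and> snd a < snd b"

lemma lexless_linear: "a = b \<or> lexless a b \<or> lexless b a"
  by (auto simp: lexless_def prod_eq_iff)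

text \<open>An edge is found from both of its ends; keeping it only at the lexicographically smaller
  one lists it once. This matters because \<open>segments_ok\<close> rejects a segment paired with
  itself or with its reversal. \<open>None\<close> stands for a neighbour outside the table.\<close>

definition edge_to :: "grid_point \<Rightarrow> grid_point option \<Rightarrow> (grid_point \<times> grid_point) list" where
  "edge_to a x = (case x of None \<Rightarrow> [] | Some b \<Rightarrow> if lexless a b then [(a, b)] else [])"

lemma in_edge_to_iff: "(a, b) \<in> set (edge_to c x) \<longleftrightarrow> a = c \<and> x = Some b \<and> lexless a b"
  by (cases b) (auto simp: edge_to_def split: option.splits)

definition drawing_edges :: "nat \<Rightarrow> (nat list \<times> grid_point) list \<Rightarrow> (grid_point \<times> grid_point) list" where
  "drawing_edges n t = concat (map (\<lambda>(l, a).
      concat (map (\<lambda>i. edge_to a (map_of t (swap_adjacent i l))) [0..<n - 1])) t)"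

lemma in_drawing_edges_iff:
  "(a, b) \<in> set (drawing_edges n t) \<longleftrightarrow> lexless a b \<and>
    (\<exists>l i. (l, a) \<in> set t \<and> i < n - 1 \<and> map_of t (swap_adjacent i l) = Some b)"
proof -
  have "(a, b) \<in> set (drawing_edges n t) \<longleftrightarrow>
      (\<exists>y\<in>set t. \<exists>i<n - 1. (a, b) \<in> set (edge_to (snd y) (map_of t (swap_adjacent i (fst y)))))"
    by (simp add: drawing_edges_def case_prod_beta Bex_def)
  also have "\<dots> \<longleftrightarrow> lexless a b \<and>
    (\<exists>l i. (l, a) \<in> set t \<and> i < n - 1 \<and> map_of t (swap_adjacent i l) = Some b)"
    by (auto simp: in_edge_to_iff) (metis fst_conv snd_conv)+
  finally show ?thesis .
qed

definition good_drawing :: "grid_point list \<Rightarrow> (grid_point \<times> grid_point) list \<Rightarrow> bool" where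
  "good_drawing ps S \<longleftrightarrow> distinct ps \<and> list_all (\<lambda>p. list_ex (\<lambda>(a, b). p = a \<or> p = b) S) ps \<and>
    sorted_wrt segments_ok S"

text \<open>The point of a permutation is looked up by its one-line notation. Distinctness of
  \<open>ps\<close> makes the lookup injective, and the ends of an edge have lines that differ by an
  adjacent swap.\<close>

lemma planar_bS:
  assumes len: "length ps = length (boolean_one_lines n)"
    and good: "good_drawing ps (drawing_edges n (zip (boolean_one_lines n) ps))"
  shows "planar (Gamma_graph n (bS n))"
proof -
  let ?t = "zip (boolean_one_lines n) ps"
  define h where "h p = the (map_of ?t (one_line n p))" for p
  have perm: "p permutes {1..n}" if "p \<in> bS n" for p
    using that by (auto simp: bS_def sym_group_def)
  have h: "map_of ?t (one_line n p) = Some (h p)" "(one_line n p, h p) \<in> set ?t" if "p \<in> bS n" for p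
  proof -
    have "one_line n p \<in> fst ` set ?t"
      using one_line_bS[OF that] len by (metis list.set_map map_fst_zip)
    then show "map_of ?t (one_line n p) = Some (h p)"
      by (metis h_def map_of_eq_None_iff option.exhaust_sel)
    then show "(one_line n p, h p) \<in> set ?t" by (rule map_of_SomeD)
  qed
  have inj: "inj_on h (bS n)"
  proof (rule inj_onI)
    fix p q assume pq: "p \<in> bS n" "q \<in> bS n" "h p = h q"
    have "distinct (map snd ?t)" using good len by (simp add: good_drawing_def)
    then have "one_line n p = one_line n q"
      using h(2)[OF pq(1)] h(2)[OF pq(2)] pq(3) by (metis distinct_map inj_onD prod.inject snd_conv)
    then show "p = q" using one_line_inj perm pq by blast
  qed
  show ?thesis
  proof (rule planar_straight_line[where S = "drawing_edges n ?t" and h = h])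
    show "inj_on h (verts (Gamma_graph n (bS n)))" using inj by simp
    show "sorted_wrt segments_ok (drawing_edges n ?t)" using good by (simp add: good_drawing_def)
    show "a \<noteq> b" if "(a, b) \<in> set (drawing_edges n ?t)" for a b
      using that by (auto simp: in_drawing_edges_iff lexless_def)
    show "\<exists>(a, b)\<in>set (drawing_edges n ?t). h u = a \<or> h u = b" if "u \<in> verts (Gamma_graph n (bS n))" for u
    proof -
      have "h u \<in> set ps" using h(2)[of u] that by (auto dest: set_zip_rightD)
      then show ?thesis using good by (auto simp: good_drawing_def list_all_iff list_ex_iff)
    qed
    fix u v assume "(u, v) \<in> arcs_ends (Gamma_graph n (bS n))"
    then obtain i where uv: "u \<in> bS n" "v \<in> bS n" "i \<in> {1..n - 1}" "v = u \<circ> tau i"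
      by (auto simp: arcs_ends_Gamma_graph[OF bS_subset])
    have u: "u = v \<circ> tau i" by (simp add: uv(4) tau_def comp_assoc)
    \<comment> \<open>Without loops the points \<open>h u\<close> and \<open>h v\<close> differ, so
      \<open>lexless\<close> orients the edge.\<close>
    have "u \<noteq> v"
    proof
      assume "u = v"
      then have "u i = u (Suc i)" using uv(4) by (metis comp_apply tau_def transpose_apply_first)
      then show False using permutes_inj[OF perm[OF uv(1)]] by (simp add: inj_eq)
    qed
    then have "h u \<noteq> h v" using inj uv by (metis inj_onD)
    moreover have "map_of ?t (swap_adjacent (i - 1) (one_line n u)) = Some (h v)"
      using h(1)[OF uv(2)] uv(3) by (simp add: uv(4) one_line_tau)
    moreover have "map_of ?t (swap_adjacent (i - 1) (one_line n v)) = Some (h u)"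
      using h(1)[OF uv(1)] uv(3) by (metis u one_line_tau)
    moreover have "i - 1 < n - 1" using uv(3) by auto
    ultimately show "u \<in> verts (Gamma_graph n (bS n)) \<and> v \<in> verts (Gamma_graph n (bS n)) \<and>
        ((h u, h v) \<in> set (drawing_edges n ?t) \<or> (h v, h u) \<in> set (drawing_edges n ?t))"
      using uv(1,2) h(2) unfolding in_drawing_edges_iff verts_Gamma_graph
      using lexless_linear[of "h u" "h v"] by blast
  qed
qed

text \<open>Found by computer search. The order is that of \<^term>\<open>boolean_one_lines 6\<close>.\<close>

definition drawing6 :: "grid_point list" where
  "drawing6 = [
    (12, 4), (4, 17), (19, 2), (13, 3), (4, 18), (14, 10), (12, 9), (11, 6), (7, 16), (5, 16),
    (15, 3), (14, 4), (7, 20), (5, 4), (6, 6), (6, 8), (7, 6), (5, 7), (3, 11), (5, 15), (11,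
    2), (16, 0), (8, 4), (7, 5), (1, 20), (2, 18), (12, 11), (10, 10), (10, 9), (8, 13), (7,
    13), (17, 4), (17, 5), (3, 19), (20, 14), (20, 17), (19, 15), (18, 14), (17, 11), (20,
    18), (18, 17), (17, 15), (16, 20), (21, 12), (21, 11), (20, 9), (19, 13), (17, 10), (15,
    8), (21, 16), (19, 21), (13, 20), (13, 15), (13, 14), (14, 13), (15, 10), (15, 14), (16,
    10), (12, 15), (8, 15), (12, 16), (15, 17), (19, 7), (19, 3), (16, 8), (18, 7), (5, 21),
    (9, 21), (4, 4), (5, 6), (4, 5), (2, 0), (4, 7), (3, 8), (1, 8), (8, 3), (10, 2), (6, 1),
    (3, 0), (1, 16), (2, 11), (13, 11), (11, 13), (9, 11), (8, 14), (9, 12), (18, 5), (18, 6),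
    (5, 19)]"

text \<open>There are 89 Boolean permutations of six points; evaluation tests all pairs of edges
  between them.\<close>

lemma planar_bS_6: "planar (Gamma_graph 6 (bS 6))"
proof (rule planar_bS)
  show "length drawing6 = length (boolean_one_lines 6)"
    by code_simp
  show "good_drawing drawing6 (drawing_edges 6 (zip (boolean_one_lines 6) drawing6))"
    by code_simp
qed

lemma bS_mono:
  assumes "m \<le> n" shows "bS m \<subseteq> bS n"
proof
  fix p assume "p \<in> bS m"
  then obtain kjs where p: "p permutes {1..m}" and kjs: "sorted_wrt (<) (map fst kjs)"
    "\<forall>(k, j)\<in>set kjs. 1 \<le> j \<and> j \<le> k \<and> k \<le> m - 1" "distinct (syllables_word kjs)" "p = word_perm (syllables_word kjs)"
    by (auto simp: bS_def canonical_word_def sym_group_def)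
  have "canonical_word n (syllables_word kjs)"
    unfolding canonical_word_def using kjs assms by (intro exI[of _ kjs]) auto
  moreover have "p permutes {1..n}" using p assms by (auto intro: permutes_subset)
  ultimately show "p \<in> bS n" using kjs by (auto simp: bS_def sym_group_def)
qed

lemma planar_bS_mono:
  assumes "planar (Gamma_graph n (bS n))" "m \<le> n"
  shows "planar (Gamma_graph m (bS m))"
proof (rule planar_mono[OF assms(1)])
  have "{1..m - 1} \<subseteq> {1..n - 1}" using assms(2) by auto
  then show "arcs_ends (Gamma_graph m (bS m)) \<subseteq> arcs_ends (Gamma_graph n (bS n))"
    using bS_mono[OF assms(2)] unfolding arcs_ends_Gamma_graph[OF bS_subset] by blast
qed (use bS_mono[OF assms(2)] in \<open>auto simp: arcs_ends_Gamma_graph[OF bS_subset]\<close>)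

subsection \<open>A subdivided complete bipartite graph\<close>

text \<open>The arc of an unordered edge may start at either end; it is reversed when it starts at
  \<open>f w\<close>.\<close>

lemma plane_drawing_arc:
  assumes "plane_drawing G f g" "{u, w} \<in> undirected_edges G" "f u \<noteq> f w"
  obtains h where "Path_Connected.arc h" "pathstart h = f u" "pathfinish h = f w"
    "path_image h = path_image (g {u, w})"
proof -
  have g: "Path_Connected.arc (g {u, w})" "{pathstart (g {u, w}), pathfinish (g {u, w})} = {f u, f w}"
    using assms(1,2) by (auto simp: plane_drawing_def)
  show thesis
  proof (cases "pathstart (g {u, w}) = f u")
    case True
    then show thesis using g that[of "g {u, w}"] by (auto simp: doubleton_eq_iff)
  next
    case False
    then show thesis using g that[of "reversepath (g {u, w})"]
      by (auto simp: doubleton_eq_iff arc_reversepath)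
  qed
qed

text \<open>The parts of the subdivided \<open>K\<^sub>3\<^sub>,\<^sub>3\<close> are the vertices \<open>v i 0\<close> and \<open>v 1 (Suc j)\<close>.\<close>

lemma claw_times_path_not_planar:
  fixes v :: "nat \<Rightarrow> nat \<Rightarrow> 'a"
  assumes verts: "\<And>i j. i < 3 \<Longrightarrow> j < 4 \<Longrightarrow> v i j \<in> verts G"
    and inj: "\<And>i j i' j'. i < 3 \<Longrightarrow> j < 4 \<Longrightarrow> i' < 3 \<Longrightarrow> j' < 4 \<Longrightarrow> v i j = v i' j' \<longleftrightarrow> i = i' \<and> j = j'"
    and claw: "\<And>i j. i < 3 \<Longrightarrow> j < 3 \<Longrightarrow> {v i 0, v i (Suc j)} \<in> undirected_edges G"
    and path: "\<And>i j. i < 3 \<Longrightarrow> i \<noteq> 1 \<Longrightarrow> j < 3 \<Longrightarrow> {v i (Suc j), v 1 (Suc j)} \<in> undirected_edges G"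
  shows "\<not> planar G"
proof
  assume "planar G"
  then obtain f g where fg: "plane_drawing G f g" by (auto simp: planar_def)
  then have f: "f x = f y \<longleftrightarrow> x = y" if "x \<in> verts G" "y \<in> verts G" for x y
    using that by (auto simp: plane_drawing_def inj_on_eq_iff)
  have cross: "path_image (g e) \<inter> path_image (g e') \<subseteq> f ` (e \<inter> e')"
    if "e \<in> undirected_edges G" "e' \<in> undirected_edges G" "e \<noteq> e'" for e e'
    using fg that by (auto simp: plane_drawing_def)
  \<comment> \<open>The edges of the path that replaces the edge from \<open>v i 0\<close> to
    \<open>v 1 (Suc j)\<close>. For \<open>i = 1\<close> this is a single edge; otherwise
    \<open>v i (Suc j)\<close> subdivides it.\<close>
  define es where "es i j = insert {v i 0, v i (Suc j)} (if i = 1 then {} else {{v i (Suc j), v 1 (Suc j)}})" for i j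
  have es: "e \<in> undirected_edges G" if "e \<in> es i j" "i < 3" "j < 3" for e i j
    using that claw path by (auto simp: es_def split: if_splits)
  define W where "W i j = {v i 0, v i (Suc j), v 1 (Suc j)}" for i j
  have es_W: "e \<subseteq> W i j" if "e \<in> es i j" for e i j
    using that by (auto simp: es_def W_def split: if_splits)
  \<comment> \<open>Two of these paths share no vertex except an end belonging to both: by
    \<open>inj\<close> a common vertex has the same pair of indices in both descriptions.\<close>
  have W: "x \<in> (if i = i' then {v i 0} else if j = j' then {v 1 (Suc j)} else {})"
    if W: "x \<in> W i j" "x \<in> W i' j'" and lt: "i < 3" "j < 3" "i' < 3" "j' < 3" "(i, j) \<noteq> (i', j')" for x i j i' j'
  proof -
    obtain a b where ab: "x = v a b" "(a, b) \<in> {(i, 0), (i, Suc j), (1, Suc j)}"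
      using W(1) unfolding W_def by blast
    obtain c d where cd: "x = v c d" "(c, d) \<in> {(i', 0), (i', Suc j'), (1, Suc j')}"
      using W(2) unfolding W_def by blast
    have "a < 3" "b < 4" "c < 3" "d < 4" using ab(2) cd(2) lt by auto
    then have "a = c" "b = d" using inj[of a b c d] ab(1) cd(1) by auto
    then have "if i = i' then (a, b) = (i, 0) else if j = j' then (a, b) = (1, Suc j) else False"
      using ab(2) cd(2) lt(5) by auto
    then show ?thesis using ab(1) by (auto split: if_splits)
  qed
  have es_Int: "e \<inter> e' \<subseteq> (if i = i' then {v i 0} else if j = j' then {v 1 (Suc j)} else {})"
    if "e \<in> es i j" "e' \<in> es i' j'" "i < 3" "j < 3" "i' < 3" "j' < 3" "(i, j) \<noteq> (i', j')" for e e' i j i' j'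
    using es_W[OF that(1)] es_W[OF that(2)] W[OF _ _ that(3-7)] by blast
  have es_two: "\<not> e \<subseteq> {z}" if e: "e \<in> es i j" "i < 3" "j < 3" for e i j z
  proof -
    have "v i 0 \<noteq> v i (Suc j)" using inj[of i 0 i "Suc j"] e by simp
    moreover have "v i (Suc j) \<noteq> v 1 (Suc j)" if "i \<noteq> 1" using inj[of i "Suc j" 1 "Suc j"] e that by simp
    moreover have "e = {v i 0, v i (Suc j)} \<or> i \<noteq> 1 \<and> e = {v i (Suc j), v 1 (Suc j)}"
      using e(1) unfolding es_def by (cases "i = 1") (simp_all only: if_True if_False insert_iff empty_iff simp_thms)
    ultimately show ?thesis by blast
  qed
  have meet: "path_image (g e) \<inter> path_image (g e')
      \<subseteq> (if i = i' then {f (v i 0)} else if j = j' then {f (v 1 (Suc j))} else {})"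
    if A: "e \<in> es i j" "e' \<in> es i' j'" "i < 3" "j < 3" "i' < 3" "j' < 3" "(i, j) \<noteq> (i', j')" for e e' i j i' j'
  proof -
    \<comment> \<open>An edge common to two different paths would be contained in a single shared
      vertex, which \<open>es_two\<close> excludes.\<close>
    have "e \<noteq> e'"
    proof
      assume eq: "e = e'"
      then have "e \<subseteq> (if i = i' then {v i 0} else if j = j' then {v 1 (Suc j)} else {})"
        using es_Int[OF A] by (simp only: Int_absorb)
      then have "\<exists>z. e \<subseteq> {z}" by (cases "i = i'"; cases "j = j'") auto
      then show False using es_two[OF A(1,3,4)] by blast
    qed
    then have "path_image (g e) \<inter> path_image (g e') \<subseteq> f ` (e \<inter> e')"
      using cross es A by blast
    then show ?thesis using es_Int[OF A] by (auto split: if_splits)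
  qed
  have arcs: "\<exists>h. Path_Connected.arc h \<and> pathstart h = f (v i 0) \<and> pathfinish h = f (v 1 (Suc j)) \<and>
      path_image h = (\<Union>e\<in>es i j. path_image (g e))" if ij: "i < 3" "j < 3" for i j
  proof -
    have "f (v i 0) \<noteq> f (v i (Suc j))" using ij inj[of i 0 i "Suc j"] by (simp add: f verts)
    then obtain h where h: "Path_Connected.arc h" "pathstart h = f (v i 0)" "pathfinish h = f (v i (Suc j))"
      "path_image h = path_image (g {v i 0, v i (Suc j)})"
      using plane_drawing_arc[OF fg claw[OF ij]] by blast
    show ?thesis
    proof (cases "i = 1")
      case True
      then show ?thesis using h by (auto simp: es_def)
    next
      case False
      then have "f (v i (Suc j)) \<noteq> f (v 1 (Suc j))" using ij inj[of i "Suc j" 1 "Suc j"] by (simp add: f verts)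
      then obtain h' where h': "Path_Connected.arc h'" "pathstart h' = f (v i (Suc j))"
        "pathfinish h' = f (v 1 (Suc j))" "path_image h' = path_image (g {v i (Suc j), v 1 (Suc j)})"
        using plane_drawing_arc[OF fg path[OF ij(1) False ij(2)]] by blast
      have edges: "{v i 0, v i (Suc j)} \<in> undirected_edges G" "{v i (Suc j), v 1 (Suc j)} \<in> undirected_edges G"
        using claw path ij False by auto
      have "{v i 0, v i (Suc j)} \<noteq> {v i (Suc j), v 1 (Suc j)}"
        "{v i 0, v i (Suc j)} \<inter> {v i (Suc j), v 1 (Suc j)} = {v i (Suc j)}"
        using ij False inj[of i 0 i "Suc j"] inj[of i 0 1 "Suc j"] inj[of i "Suc j" 1 "Suc j"]
        by (auto simp: doubleton_eq_iff)
      then have "path_image h \<inter> path_image h' \<subseteq> {pathstart h'}"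
        using cross[OF edges] h h' by auto
      then have "Path_Connected.arc (h +++ h')"
        using h h' by (intro arc_join) auto
      moreover have "path_image (h +++ h') = (\<Union>e\<in>es i j. path_image (g e))"
        using h h' False by (simp add: path_image_join es_def)
      ultimately show ?thesis using h h' by (intro exI[of _ "h +++ h'"]) simp
    qed
  qed
  have "\<exists>h. \<forall>i j. i < 3 \<and> j < 3 \<longrightarrow> Path_Connected.arc (h i j) \<and> pathstart (h i j) = f (v i 0) \<and>
      pathfinish (h i j) = f (v 1 (Suc j)) \<and> path_image (h i j) = (\<Union>e\<in>es i j. path_image (g e))"
    using arcs by metis
  then obtain h where h: "\<And>i j. i < 3 \<Longrightarrow> j < 3 \<Longrightarrow> Path_Connected.arc (h i j) \<and> pathstart (h i j) = f (v i 0) \<and>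
      pathfinish (h i j) = f (v 1 (Suc j)) \<and> path_image (h i j) = (\<Union>e\<in>es i j. path_image (g e))"
    by blast
  show False
  proof (rule K33_not_plane[of h "\<lambda>i. f (v i 0)" "\<lambda>j. f (v 1 (Suc j))"])
    fix i j i' j' :: nat
    assume A: "i < 3" "j < 3" "i' < 3" "j' < 3" "(i, j) \<noteq> (i', j')"
    show "path_image (h i j) \<inter> path_image (h i' j')
        \<subseteq> (if i = i' then {f (v i 0)} else if j = j' then {f (v 1 (Suc j))} else {})"
    proof
      fix x assume "x \<in> path_image (h i j) \<inter> path_image (h i' j')"
      then obtain e e' where "e \<in> es i j" "e' \<in> es i' j'" "x \<in> path_image (g e) \<inter> path_image (g e')"
        using h A by auto
      then show "x \<in> (if i = i' then {f (v i 0)} else if j = j' then {f (v 1 (Suc j))} else {})"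
        using meet[of e i j e' i' j'] A by blast
    qed
  qed (use h in auto)
qed

section \<open>Adjacent transpositions and the words they form\<close>

lemma tau_comp_tau [simp]: "tau i \<circ> tau i = id"
  by (simp add: tau_def)

lemma tau_permutes: "i \<in> {1..n - 1} \<Longrightarrow> tau i permutes {1..n}"
  unfolding tau_def by (rule permutes_swap_id) auto

lemma tau_commute: "Suc i < k \<Longrightarrow> tau i \<circ> tau k = tau k \<circ> tau i"
  by (auto simp: tau_def fun_eq_iff Transposition.transpose_def)

lemma word_perm_simps [simp]:
  "word_perm [] = id" "word_perm (i # w) = tau i \<circ> word_perm w"
  by (simp_all add: word_perm_def)

lemma word_perm_append: "word_perm (u @ w) = word_perm u \<circ> word_perm w"
  by (induction u) (auto simp: comp_assoc)

lemma word_perm_permutes: "set w \<subseteq> {1..n - 1} \<Longrightarrow> word_perm w permutes {1..n}"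
proof (induction w)
  case (Cons i w)
  then have "word_perm w permutes {1..n}" and i: "i \<in> {1..n - 1}" by auto
  moreover have "tau i permutes {1..n}" by (rule tau_permutes[OF i])
  ultimately show ?case unfolding word_perm_simps by (blast intro: permutes_compose)
qed (simp add: permutes_id)

lemma canonical_word_letters:
  assumes "canonical_word n w" shows "set w \<subseteq> {1..n - 1}"
proof -
  obtain kjs where "\<forall>(k, j)\<in>set kjs. 1 \<le> j \<and> j \<le> k \<and> k \<le> n - 1" "w = syllables_word kjs"
    using assms by (auto simp: canonical_word_def)
  then show ?thesis by (fastforce simp: D_word_def)
qed

lemma bS_memI:
  assumes "canonical_word n w" "distinct w"
  shows "word_perm w \<in> bS n"
  using assms word_perm_permutes[OF canonical_word_letters[OF assms(1)]]
  by (auto simp: bS_def sym_group_def)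

text \<open>The factors \<open>b j\<close> stand on the right, so the claw edges are immediate. For
  the path edges \<open>tau 2\<close> or \<open>tau 1\<close> has to pass
  \<open>tau (j + 4)\<close>, with which it commutes because the indices differ by at least two. The
  largest letter is 6, hence the bound on \<open>n\<close>.\<close>

lemma Gamma_bS_not_planar:
  assumes "7 \<le> n"
  shows "\<not> planar (Gamma_graph n (bS n))"
proof -
  \<comment> \<open>\<open>u i\<close> and \<open>t j\<close> are the syllables of the factors
    \<open>a i\<close> and \<open>b j\<close>. The leading letters in \<open>t j\<close> exceed
    those in \<open>u i\<close>, so the concatenation is canonical. The shift by 3 turns
    \<open>j = 1, 2, 3\<close> into the letters 4, 5, 6.\<close>
  define u where "u i = (if i = 0 then [] else if i = 1 then [(2, 2)] else [(2, 1)] :: (nat \<times> nat) list)" for i :: nat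
  define t where "t j = (if j = 0 then [] else [(j + 3, j + 3)] :: (nat \<times> nat) list)" for j :: nat
  define a where "a i = (if i = 0 then id else if i = 1 then tau 2 else tau 2 \<circ> tau 1)" for i :: nat
  define b where "b j = (if j = 0 then id else tau (j + 3))" for j :: nat
  define v where "v i j = a i \<circ> b j" for i j
  have bS: "v i j \<in> bS n" if "i < 3" "j < 4" for i j
  proof -
    have "canonical_word n (syllables_word (u i @ t j))"
      unfolding canonical_word_def using assms that
      by (intro exI[of _ "u i @ t j"]) (auto simp: u_def t_def)
    moreover have "distinct (syllables_word (u i @ t j))"
      using that by (auto simp: u_def t_def D_word_def)
    moreover have "D_word 2 1 = [2, 1]" "D_word k k = [k]" for k
      by (simp_all add: D_word_def numeral_2_eq_2)
    then have "word_perm (syllables_word (u i @ t j)) = v i j"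
      by (simp add: v_def u_def t_def a_def b_def comp_assoc)
    ultimately show ?thesis using bS_memI by metis
  qed
  have v: "v 0 0 = id" "v 1 0 = tau 2" "v 2 0 = tau 2 \<circ> tau 1"
    "v 0 (Suc j) = tau (j + 4)" "v 1 (Suc j) = tau 2 \<circ> tau (j + 4)"
    "v 2 (Suc j) = tau 2 \<circ> tau 1 \<circ> tau (j + 4)" for j
    by (simp_all add: v_def a_def b_def add.commute)
  have lt3: "i < 3 \<longleftrightarrow> i = 0 \<or> i = 1 \<or> i = 2" for i :: nat by auto
  have edge: "{p, q} \<in> undirected_edges (Gamma_graph n (bS n))"
    if "p \<in> bS n" "q \<in> bS n" "k \<in> {1..n - 1}" "q = p \<circ> tau k \<or> p = q \<circ> tau k" for p q k
  proof -
    have "p = q \<circ> tau k \<or> q = p \<circ> tau k" using that(4) by blast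
    then have "(p, q) \<in> arcs_ends (Gamma_graph n (bS n)) \<or> (q, p) \<in> arcs_ends (Gamma_graph n (bS n))"
      using that(1-3) unfolding arcs_ends_Gamma_graph[OF bS_subset] by blast
    then show ?thesis
    proof
      assume "(p, q) \<in> arcs_ends (Gamma_graph n (bS n))"
      then show ?thesis unfolding undirected_edges_def by blast
    next
      assume "(q, p) \<in> arcs_ends (Gamma_graph n (bS n))"
      then have "{q, p} \<in> undirected_edges (Gamma_graph n (bS n))" unfolding undirected_edges_def by blast
      then show ?thesis by (simp only: insert_commute[of p q])
    qed
  qed
  show ?thesis
  proof (rule claw_times_path_not_planar[of v])
    show "v i j \<in> verts (Gamma_graph n (bS n))" if "i < 3" "j < 4" for i j
      using bS that by simp
    show "{v i 0, v i (Suc j)} \<in> undirected_edges (Gamma_graph n (bS n))" if ij: "i < 3" "j < 3" for i j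
    proof (rule edge[of _ _ "j + 4"])
      have "v i (Suc j) = v i 0 \<circ> tau (j + 4)"
        using ij(1) unfolding lt3 by (elim disjE) (simp_all only: v id_comp)
      then show "v i (Suc j) = v i 0 \<circ> tau (j + 4) \<or> v i 0 = v i (Suc j) \<circ> tau (j + 4)" ..
    qed (use ij assms bS in auto)
    show "{v i (Suc j), v 1 (Suc j)} \<in> undirected_edges (Gamma_graph n (bS n))"
      if ij: "i < 3" "i \<noteq> 1" "j < 3" for i j
    proof (cases "i = 0")
      case True
      have "v 1 (Suc j) = v 0 (Suc j) \<circ> tau 2"
        unfolding v by (rule tau_commute) simp
      moreover have "v 0 (Suc j) \<in> bS n" "v 1 (Suc j) \<in> bS n" "2 \<in> {1..n - 1}"
        using bS ij assms by auto
      ultimately show ?thesis using edge unfolding True by blast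
    next
      case False
      have "tau 1 \<circ> tau (j + 4) = tau (j + 4) \<circ> tau 1" by (rule tau_commute) simp
      then have "v 2 (Suc j) = v 1 (Suc j) \<circ> tau 1"
        by (simp only: v comp_assoc)
      moreover have "v 2 (Suc j) \<in> bS n" "v 1 (Suc j) \<in> bS n" "1 \<in> {1..n - 1}"
        using bS ij assms by auto
      moreover have i: "i = 2" using False ij by auto
      ultimately show ?thesis using edge unfolding i by blast
    qed
    show "v i j = v i' j' \<longleftrightarrow> i = i' \<and> j = j'" if A: "i < 3" "j < 4" "i' < 3" "j' < 4" for i j i' j'
    proof
      assume eq: "v i j = v i' j'"
      \<comment> \<open>\<open>a i\<close> moves only points up to 3 and \<open>b j\<close> only
        points from 4 on, so the values at 1 and 2 determine \<open>i\<close>, and those at 4, 5 and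
        6 determine \<open>j\<close>.\<close>
      have a: "a i x = (if i = 0 \<or> x \<ge> 4 then x else if i = 1 then (if x = 2 then 3 else if x = 3 then 2 else x)
          else (if x = 1 then 3 else if x = 2 then 1 else if x = 3 then 2 else x))" for i x
        by (auto simp: a_def tau_def Transposition.transpose_def)
      have b: "b j x = (if j = 0 then x else if x = j + 3 then j + 4 else if x = j + 4 then j + 3 else x)" for j x
        by (auto simp: b_def tau_def Transposition.transpose_def)
      have v12: "v i j 1 = (if i = 0 \<or> i = 1 then 1 else 3)" "v i j 2 = (if i = 0 then 2 else if i = 1 then 3 else 1)" for i j
        by (auto simp: v_def a b)
      have v456: "v i j 4 = (if j = 1 then 5 else 4)" "v i j 5 = (if j = 1 then 4 else if j = 2 then 6 else 5)"
          "v i j 6 = (if j = 2 then 5 else if j = 3 then 7 else 6)" for i j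
        by (auto simp: v_def a b)
      have "v i j x = v i' j' x" for x using eq by simp
      note eqs = this[of 1] this[of 2] this[of 4] this[of 5] this[of 6]
      have "i = 0 \<or> i = 1 \<or> i = 2" "i' = 0 \<or> i' = 1 \<or> i' = 2" using A by auto
      then have "i = i'" using eqs(1,2) unfolding v12 by (elim disjE) simp_all
      moreover have "j = 0 \<or> j = 1 \<or> j = 2 \<or> j = 3" "j' = 0 \<or> j' = 1 \<or> j' = 2 \<or> j' = 3" using A by auto
      then have "j = j'" using eqs(3-5) unfolding v456 by (elim disjE) simp_all
      ultimately show "i = i' \<and> j = j'" ..
    qed simp
  qed
qed

subsection \<open>Connectedness\<close>

text \<open>Connectedness means strong connectedness of the symmetric closure, so one can go from a
  vertex back to \<open>id\<close> and on to any other. Membership of \<open>id\<close> also gives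
  the nonempty vertex set that the notion demands.\<close>

lemma connected_Gamma_graphI:
  assumes "A \<subseteq> carrier (sym_group n)" "id \<in> A"
    and reach: "\<And>p. p \<in> A \<Longrightarrow> (id, p) \<in> (arcs_ends (Gamma_graph n A))\<^sup>*"
  shows "Digraph_Component.connected (Gamma_graph n A)"
proof -
  let ?R = "arcs_ends (Gamma_graph n A)"
  let ?H = "with_proj (mk_symmetric (Gamma_graph n A))"
  have R: "arcs_ends ?H = ?R \<union> ?R\<inverse>"
    by (auto simp: mk_symmetric_def arcs_ends_conv)
  have V: "verts ?H = A" by (simp add: mk_symmetric_def)
  have "(p, q) \<in> (arcs_ends ?H)\<^sup>*" if "p \<in> A" "q \<in> A" for p q
  proof -
    have "(p, id) \<in> (?R\<inverse>)\<^sup>*" "(id, q) \<in> ?R\<^sup>*"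
      using reach that by (auto simp: rtrancl_converse)
    then show ?thesis unfolding R by (meson in_rtrancl_UnI rtrancl_trans)
  qed
  moreover have "arcs_ends ?H \<subseteq> A \<times> A"
    unfolding R arcs_ends_Gamma_graph[OF assms(1)] by blast
  ultimately have "(p, q) \<in> rtrancl_on A (arcs_ends ?H)" if "p \<in> A" "q \<in> A" for p q
    using that by (intro rtrancl_consistent_rtrancl_on) blast+
  then show ?thesis
    using assms(2) unfolding connected_def strongly_connected_def reachable_def V by blast
qed

lemma not_connected_Gamma_graphI:
  assumes A: "A \<subseteq> carrier (sym_group n)" and p: "p \<in> A" "q \<in> A" "p \<noteq> q"
    and isolated: "\<And>i. i \<in> {1..n - 1} \<Longrightarrow> p \<circ> tau i \<notin> A"
  shows "\<not> Digraph_Component.connected (Gamma_graph n A)"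
proof
  let ?H = "with_proj (mk_symmetric (Gamma_graph n A))"
  let ?R = "arcs_ends (Gamma_graph n A)"
  assume "Digraph_Component.connected (Gamma_graph n A)"
  then have "(p, q) \<in> rtrancl_on (verts ?H) (arcs_ends ?H)"
    using p by (auto simp: connected_def strongly_connected_def reachable_def mk_symmetric_def)
  then have "(p, q) \<in> (arcs_ends ?H)\<^sup>*" by (rule rtrancl_on_rtranclI)
  then obtain r where r: "(p, r) \<in> arcs_ends ?H" using p(3) by (meson converse_rtranclE)
  \<comment> \<open>As \<open>tau i\<close> is an involution, an arc in either direction leads from
    \<open>p\<close> to \<open>p \<circ> tau i\<close>.\<close>
  have "(r \<circ> tau i) \<circ> tau i = r" for i by (simp add: comp_assoc)
  moreover have "arcs_ends ?H = ?R \<union> ?R\<inverse>"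
    by (auto simp: mk_symmetric_def arcs_ends_conv)
  then obtain i where i: "r \<in> A" "i \<in> {1..n - 1}" "r = p \<circ> tau i \<or> p = r \<circ> tau i"
    using r unfolding arcs_ends_Gamma_graph[OF A] by auto
  ultimately have "r = p \<circ> tau i" by metis
  then show False using isolated i by blast
qed

text \<open>Removing the last letter turns the last syllable \<open>D_word k j\<close> into
  \<open>D_word k (Suc j)\<close>, or deletes it when \<open>j = k\<close>.\<close>

lemma canonical_word_butlast:
  assumes "canonical_word n w" "w \<noteq> []"
  shows "canonical_word n (butlast w)"
proof -
  obtain kjs where kjs: "sorted_wrt (<) (map fst kjs)" "\<forall>(k, j)\<in>set kjs. 1 \<le> j \<and> j \<le> k \<and> k \<le> n - 1"
    and w: "w = syllables_word kjs"
    using assms(1) by (auto simp: canonical_word_def)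
  have "kjs \<noteq> []" using w assms(2) by auto
  then obtain ks k j where ks: "kjs = ks @ [(k, j)]" by (metis rev_exhaust surj_pair)
  have jk: "1 \<le> j" "j \<le> k" "k \<le> n - 1" using kjs(2) by (auto simp: ks)
  then have "D_word k j = D_word k (Suc j) @ [j]"
    by (simp add: D_word_def upt_conv_Cons del: upt_Suc)
  then have but: "butlast w = syllables_word ks @ D_word k (Suc j)"
    by (simp add: w ks butlast_append)
  show ?thesis
  proof (cases "j = k")
    case True
    then have "butlast w = syllables_word ks" using but by (simp add: D_word_def)
    then show ?thesis using kjs unfolding canonical_word_def
      by (intro exI[of _ ks]) (auto simp: ks sorted_wrt_append)
  next
    case False
    have "butlast w = syllables_word (ks @ [(k, Suc j)])" using but by simp
    then show ?thesis using kjs jk False unfolding canonical_word_def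
      by (intro exI[of _ "ks @ [(k, Suc j)]"]) (auto simp: ks sorted_wrt_append)
  qed
qed

text \<open>The prefixes of a Boolean canonical word are again such words, and appending a letter is
  right multiplication by a generator, so they form a path starting at \<open>id\<close>.\<close>

lemma connected_bS: "Digraph_Component.connected (Gamma_graph n (bS n))"
proof (rule connected_Gamma_graphI[OF bS_subset])
  let ?R = "arcs_ends (Gamma_graph n (bS n))"
  have "canonical_word n []" unfolding canonical_word_def by (intro exI[of _ "[]"]) simp
  from bS_memI[OF this] show "id \<in> bS n" by simp
  fix p assume "p \<in> bS n"
  then obtain w where w: "canonical_word n w" "distinct w" "p = word_perm w"
    by (auto simp: bS_def)
  have "(id, word_perm w) \<in> ?R\<^sup>*" using w(1,2)
  proof (induction w rule: rev_induct)
    case (snoc i w)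
    have w: "canonical_word n w" using canonical_word_butlast[OF snoc.prems(1)] by simp
    have i: "i \<in> {1..n - 1}" using canonical_word_letters[OF snoc.prems(1)] by simp
    have "word_perm w \<in> bS n" "word_perm (w @ [i]) \<in> bS n"
      using w snoc.prems by (auto intro: bS_memI simp del: word_perm_simps)
    then have "(word_perm w, word_perm (w @ [i])) \<in> ?R"
      using i by (auto simp: arcs_ends_Gamma_graph[OF bS_subset] word_perm_append)
    then show ?case using snoc w by (meson distinct1_rotate distinct_append rtrancl.rtrancl_into_rtrancl)
  qed simp
  then show "(id, p) \<in> ?R\<^sup>*" by (simp add: w)
qed

section \<open>Connectedness certificates for explicit lists of permutations\<close>

lemma one_line_id: "one_line n id = [1..<Suc n]"
  by (simp add: one_line_def del: upt_Suc)

text \<open>A certificate to be read from the end: the last line is the identity, and every other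
  line is an adjacent swap away from one that follows it.\<close>

fun grows :: "nat \<Rightarrow> nat list list \<Rightarrow> bool" where
  "grows n (l # l' # ls) \<longleftrightarrow>
     list_ex (\<lambda>i. swap_adjacent i l \<in> set (l' # ls)) [0..<n - 1] \<and> grows n (l' # ls)"
| "grows n [l] \<longleftrightarrow> l = [1..<Suc n]"
| "grows n [] \<longleftrightarrow> False"

lemma connected_one_lines:
  assumes A: "A \<subseteq> carrier (sym_group n)"
    and L: "\<And>p. p permutes {1..n} \<Longrightarrow> p \<in> A \<longleftrightarrow> one_line n p \<in> set L"
    and grows: "grows n L"
  shows "Digraph_Component.connected (Gamma_graph n A)"
proof (rule connected_Gamma_graphI[OF A])
  let ?R = "arcs_ends (Gamma_graph n A)"
  have last: "[1..<Suc n] \<in> set ls" if "grows n ls" for ls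
    using that by (induction n ls rule: grows.induct) (auto simp del: upt_Suc)
  show "id \<in> A" using L[OF permutes_id] last[OF grows] by (simp only: one_line_id)
  have reach: "(id, p) \<in> ?R\<^sup>*"
    if "grows m ls" "m = n" "set ls \<subseteq> set L" "p permutes {1..n}" "one_line n p \<in> set ls" for p m ls
    using that
  proof (induction m ls arbitrary: p rule: grows.induct)
    case (1 m l l' ls)
    show ?case
    proof (cases "one_line n p \<in> set (l' # ls)")
      case True
      then show ?thesis using 1 by simp
    next
      case False
      then have l: "l = one_line n p" using "1.prems" by simp
      obtain i where i: "i < n - 1" "swap_adjacent i l \<in> set (l' # ls)"
        using "1.prems" by (auto simp: list_ex_iff)
      define q where "q = p \<circ> tau (Suc i)"
      have Suc_i: "Suc i \<in> {1..n - 1}" using i by simp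
      have q: "q permutes {1..n}"
        unfolding q_def using "1.prems" tau_permutes[OF Suc_i] by (intro permutes_compose)
      have line_q: "one_line n q \<in> set (l' # ls)"
        using i(2) one_line_tau[OF Suc_i] by (simp add: q_def l)
      then have id_q: "(id, q) \<in> ?R\<^sup>*"
        by (intro "1.IH") (use "1.prems" q in simp_all)
      moreover have "p = q \<circ> tau (Suc i)" by (simp add: q_def comp_assoc)
      moreover have "p \<in> A" "q \<in> A" using L line_q q "1.prems" by auto
      ultimately have "(q, p) \<in> ?R" using Suc_i unfolding arcs_ends_Gamma_graph[OF A] by blast
      with id_q show ?thesis by (rule rtrancl_into_rtrancl)
    qed
  next
    case (2 m l)
    then have "one_line n p = one_line n id" by (simp add: one_line_id del: upt_Suc)
    then have "p = id" using one_line_inj "2.prems" permutes_id by blast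
    then show ?case by simp
  qed simp
  fix p assume "p \<in> A"
  then have "p permutes {1..n}" "one_line n p \<in> set L" using A L by (auto simp: sym_group_def)
  then show "(id, p) \<in> ?R\<^sup>*" using reach[OF grows refl] by blast
qed

subsection \<open>Permutations with a single nontrivial cycle\<close>

lemma orbit_eq:
  assumes "permutation p" "y \<in> Orbits.orbit p x"
  shows "Orbits.orbit p y = Orbits.orbit p x"
  using orbit_cyclic_eq3[OF cyclic_on_orbit'] assms by metis

lemma two_le_card_orbit:
  assumes "permutation p"
  shows "2 \<le> card (Orbits.orbit p x) \<longleftrightarrow> p x \<noteq> x"
proof
  assume "2 \<le> card (Orbits.orbit p x)"
  then show "p x \<noteq> x" using orbit_eq_singleton_iff[of p x] by auto
next
  assume "p x \<noteq> x"
  moreover have "{x, p x} \<subseteq> Orbits.orbit p x"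
    using permutation_self_in_orbit[OF assms] by (auto intro: orbit.base)
  moreover have "finite (Orbits.orbit p x)"
    using permutation_self_in_orbit[OF assms] by (rule finite_orbit)
  ultimately show "2 \<le> card (Orbits.orbit p x)"
    using card_mono[of "Orbits.orbit p x" "{x, p x}"] by simp
qed

text \<open>The nontrivial cycles are the orbits of the moved points, and there is at most one
  exactly when any two moved points share an orbit.\<close>

lemma cS_iff:
  "p \<in> cS n \<longleftrightarrow> p permutes {1..n} \<and>
    (\<forall>x\<in>{1..n}. \<forall>y\<in>{1..n}. p x \<noteq> x \<longrightarrow> p y \<noteq> y \<longrightarrow> y \<in> Orbits.orbit p x)"
proof (cases "p permutes {1..n}")
  case True
  then have p: "permutation p" by (auto simp: permutation_permutes)
  have *: "{C \<in> Orbits.orbit p ` {1..n}. 2 \<le> card C} = Orbits.orbit p ` {x \<in> {1..n}. p x \<noteq> x}"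
    using two_le_card_orbit[OF p] by auto
  have fin: "finite (Orbits.orbit p ` {x \<in> {1..n}. p x \<noteq> x})" by simp
  have eq: "Orbits.orbit p x = Orbits.orbit p y \<longleftrightarrow> y \<in> Orbits.orbit p x" for x y
    using orbit_eq[OF p, of y x] permutation_self_in_orbit[OF p, of y] by metis
  have "p \<in> cS n \<longleftrightarrow> card {C \<in> Orbits.orbit p ` {1..n}. 2 \<le> card C} \<le> Suc 0"
    using True by (simp add: cS_def sym_group_def)
  also have "\<dots> \<longleftrightarrow> card (Orbits.orbit p ` {x \<in> {1..n}. p x \<noteq> x}) \<le> Suc 0"
    unfolding * ..
  also have "\<dots> \<longleftrightarrow> (\<forall>x\<in>{1..n}. \<forall>y\<in>{1..n}. p x \<noteq> x \<longrightarrow> p y \<noteq> y \<longrightarrow>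
      Orbits.orbit p x = Orbits.orbit p y)"
    unfolding card_le_Suc0_iff_eq[OF fin] by blast
  also have "\<dots> \<longleftrightarrow> (\<forall>x\<in>{1..n}. \<forall>y\<in>{1..n}. p x \<noteq> x \<longrightarrow> p y \<noteq> y \<longrightarrow> y \<in> Orbits.orbit p x)"
    unfolding eq ..
  finally show ?thesis using True by blast
qed (simp add: cS_def sym_group_def)

lemma cS_subset: "cS n \<subseteq> carrier (sym_group n)"
  by (auto simp: cS_def)

text \<open>From \<open>i\<close> the new map goes to \<open>p (Suc i)\<close>, follows
  \<open>p\<close> until it reaches \<open>i\<close>, and starts again, so it never passes
  \<open>Suc i\<close>. For a permutation this is the splitting of a cycle by a transposition of two
  of its points.\<close>

lemma orbit_comp_tau:
  assumes "i \<in> Orbits.orbit p (Suc i)"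
  shows "Suc i \<notin> Orbits.orbit (p \<circ> tau i) i"
proof -
  define a where "a = (LEAST k. 0 < k \<and> (p ^^ k) (Suc i) = i)"
  have "\<exists>k. 0 < k \<and> (p ^^ k) (Suc i) = i"
    using assms by (auto simp: orbit_altdef)
  then have a: "0 < a" "(p ^^ a) (Suc i) = i"
    unfolding a_def by (metis (mono_tags, lifting) LeastI_ex)+
  have min: "(p ^^ k) (Suc i) \<noteq> i" if "0 < k" "k < a" for k
    using that not_less_Least unfolding a_def by blast
  \<comment> \<open>A return to \<open>Suc i\<close> after \<open>k < a\<close> steps would leave
    only \<open>a - k\<close> steps to \<open>i\<close>, fewer than the minimal number
    \<open>a\<close>.\<close>
  have ne: "(p ^^ k) (Suc i) \<noteq> Suc i" if "0 < k" "k < a" for k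
  proof
    assume "(p ^^ k) (Suc i) = Suc i"
    then have "(p ^^ (a - k)) (Suc i) = (p ^^ (a - k + k)) (Suc i)"
      by (simp add: funpow_add)
    also have "\<dots> = i" using a that by simp
    finally show False using min[of "a - k"] that by simp
  qed
  have "\<exists>k. 0 < k \<and> k \<le> a \<and> y = (p ^^ k) (Suc i)" if "y \<in> Orbits.orbit (p \<circ> tau i) i" for y
    using that
  proof (induction y rule: orbit.induct)
    case base
    show ?case using a(1) by (intro exI[of _ 1]) (auto simp: tau_def)
  next
    case (step y)
    then obtain k where k: "0 < k" "k \<le> a" "y = (p ^^ k) (Suc i)" by blast
    show ?case
    proof (cases "k = a")
      case True
      then show ?thesis using k a by (intro exI[of _ 1]) (auto simp: tau_def)
    next
      case False
      then have "y \<noteq> i" "y \<noteq> Suc i" using k min ne by auto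
      then show ?thesis using k False by (intro exI[of _ "Suc k"]) (auto simp: tau_def)
    qed
  qed
  moreover have "(p ^^ k) (Suc i) \<noteq> Suc i" if "0 < k" "k \<le> a" for k
    using ne a that by (cases "k = a") auto
  ultimately show ?thesis by metis
qed

text \<open>By \<open>orbit_comp_tau\<close> the product separates \<open>i\<close> from
  \<open>Suc i\<close>, and \<open>far\<close> says that it fixes neither, so it has two nontrivial
  cycles.\<close>

lemma cS_isolated:
  assumes p: "p permutes {1..n}" and cyc: "\<And>x y. x \<in> {1..n} \<Longrightarrow> y \<in> {1..n} \<Longrightarrow> y \<in> Orbits.orbit p x"
    and i: "i \<in> {1..n - 1}" and far: "p i \<noteq> Suc i" "p (Suc i) \<noteq> i"
  shows "p \<circ> tau i \<notin> cS n"
proof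
  assume "p \<circ> tau i \<in> cS n"
  moreover have "(p \<circ> tau i) i \<noteq> i" "(p \<circ> tau i) (Suc i) \<noteq> Suc i"
    using far by (auto simp: tau_def)
  ultimately have "Suc i \<in> Orbits.orbit (p \<circ> tau i) i"
    using i unfolding cS_iff by auto
  moreover have "i \<in> Orbits.orbit p (Suc i)" using cyc[of "Suc i" i] i by auto
  ultimately show False using orbit_comp_tau by blast
qed

lemma not_connected_cS:
  assumes n: "5 \<le> n"
  shows "\<not> Digraph_Component.connected (Gamma_graph n (cS n))"
proof -
  \<comment> \<open>The cycle runs through the odd numbers 1, 3, 5, ..., then through the even
    numbers 2, 4, ..., and back to 1. As \<open>5 \<le> n\<close>, the last odd number is at least 5
    and the last even one at least 4, so no step joins consecutive numbers.\<close>
  define p where "p j = (if j = 0 \<or> n < j then j else if j + 2 \<le> n then j + 2 else if odd j then 2 else 1)" for j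
  have p: "p permutes {1..n}"
  proof (rule bij_imp_permutes)
    have "inj_on p {1..n}"
    proof (rule inj_onI)
      fix x y assume xy: "x \<in> {1..n}" "y \<in> {1..n}" "p x = p y"
      show "x = y"
      \<comment> \<open>Values above 2 have the form \<open>z + 2\<close>; the values 1 and 2 are
        taken at the two largest points, which differ in parity.\<close>
      proof (cases "x + 2 \<le> n \<or> y + 2 \<le> n")
        case True
        have "p z = z + 2 \<and> z + 2 \<le> n \<or> p z \<le> 2 \<and> \<not> z + 2 \<le> n" if "z \<in> {1..n}" for z
          using that by (simp add: p_def)
        from this[OF xy(1)] this[OF xy(2)] show ?thesis using True xy by auto
      next
        case False
        have "p z = (if odd z then 2 else 1)" if "z \<in> {1..n}" "\<not> z + 2 \<le> n" for z
          using that by (simp add: p_def)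
        from this[OF xy(1)] this[OF xy(2)] have "(if odd x then 2 else 1) = (if odd y then 2 else (1::nat))"
          using False xy(3) by metis
        then have "even x \<longleftrightarrow> even y" by (simp split: if_splits)
        then show ?thesis using False xy by simp presburger
      qed
    qed
    moreover have "p ` {1..n} \<subseteq> {1..n}" using n by (auto simp: p_def)
    ultimately show "bij_betw p {1..n} {1..n}" by (simp add: bij_betw_def endo_inj_surj)
  qed (auto simp: p_def)
  then have perm: "permutation p" by (auto simp: permutation_permutes)
  have odd: "x \<in> Orbits.orbit p 1" if "odd x" "x \<le> n" for x
    using that
  proof (induction x rule: less_induct)
    case (less x)
    show ?case
    proof (cases "x = 1")
      case True
      then show ?thesis using permutation_self_in_orbit[OF perm] by simp
    next
      case False
      then have "x \<ge> 3" using less.prems by presburger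
      then have "x - 2 \<in> Orbits.orbit p 1" using less.prems by (intro less.IH) auto
      moreover have "p (x - 2) = x" using \<open>x \<ge> 3\<close> less.prems by (auto simp: p_def)
      ultimately show ?thesis by (metis orbit.step)
    qed
  qed
  have even: "x \<in> Orbits.orbit p 1" if "even x" "0 < x" "x \<le> n" for x
    using that
  proof (induction x rule: less_induct)
    case (less x)
    show ?case
    proof (cases "x = 2")
      case True
      \<comment> \<open>The largest odd number up to \<open>n\<close>; its image 2 links the even
        numbers to the odd ones.\<close>
      define m where "m = (if odd n then n else n - 1)"
      have "m \<in> Orbits.orbit p 1" using odd[of m] n by (simp add: m_def)
      moreover have "p m = 2" using n by (auto simp: p_def m_def)
      ultimately show ?thesis using True by (metis orbit.step)
    next
      case False
      then have "x \<ge> 4" using less.prems by presburger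
      then have "x - 2 \<in> Orbits.orbit p 1" using less.prems by (intro less.IH) auto
      moreover have "p (x - 2) = x" using \<open>x \<ge> 4\<close> less.prems by (auto simp: p_def)
      ultimately show ?thesis by (metis orbit.step)
    qed
  qed
  have "x \<in> Orbits.orbit p 1" if "x \<in> {1..n}" for x
    using odd[of x] even[of x] that by (cases "even x") auto
  then have cyc: "y \<in> Orbits.orbit p x" if "x \<in> {1..n}" "y \<in> {1..n}" for x y
    using orbit_eq[OF perm, of x 1] that by auto
  show ?thesis
  proof (rule not_connected_Gamma_graphI[OF cS_subset, of p _ id])
    show "p \<in> cS n" using p cyc by (auto simp: cS_iff)
    show "id \<in> cS n" by (auto simp: cS_iff permutes_id)
    show "p \<noteq> id" using n by (auto simp: p_def fun_eq_iff intro!: exI[of _ 1])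
    show "p \<circ> tau i \<notin> cS n" if "i \<in> {1..n - 1}" for i
      using that n by (intro cS_isolated[OF p cyc]) (auto simp: p_def)
  qed
qed

section \<open>Certificates for cycles on at most four points\<close>

definition act :: "nat list \<Rightarrow> nat \<Rightarrow> nat" where
  "act l x = l ! (x - 1)"

lemma act_one_line: "x \<in> {1..n} \<Longrightarrow> act (one_line n p) x = p x"
  by (auto simp: act_def one_line_def simp del: upt_Suc)

text \<open>Only meant for lines of length at most 4: the orbits are followed for three steps.\<close>

definition one_cycle :: "nat list \<Rightarrow> bool" where
  "one_cycle l \<longleftrightarrow> (let xs = [1..<Suc (length l)] in list_all (\<lambda>x. list_all (\<lambda>y.
     act l x = x \<or> act l y = y \<or> y \<in> {x, act l x, act l (act l x), act l (act l (act l x))}) xs) xs)"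

text \<open>A 2-cycle together with a moved point outside it. On four points two nontrivial cycles
  are always 2-cycles, so this detects every permutation outside \<open>cS 4\<close>.\<close>

definition involution_cycle :: "nat list \<Rightarrow> bool" where
  "involution_cycle l \<longleftrightarrow> (let xs = [1..<Suc (length l)] in list_ex (\<lambda>x. list_ex (\<lambda>y.
     act l x \<noteq> x \<and> act l y \<noteq> y \<and> act l (act l x) = x \<and> y \<noteq> x \<and> y \<noteq> act l x) xs) xs)"

abbreviation all_lines :: "nat \<Rightarrow> nat list list" where
  "all_lines n \<equiv> filter distinct (List.n_lists n [1..<Suc n])"

lemma one_line_all_lines:
  assumes "p permutes {1..n}" shows "one_line n p \<in> set (all_lines n)"
proof -
  have "distinct (one_line n p)"
    unfolding one_line_def distinct_map using permutes_inj_on[OF assms] by (simp del: upt_Suc)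
  moreover have "set (one_line n p) \<subseteq> set [1..<Suc n]"
    by (simp only: one_line_def set_map set_upt atLeastLessThanSuc_atLeastAtMost permutes_image[OF assms] order_refl)
  moreover have "length (one_line n p) = n" by (simp add: one_line_def del: upt_Suc)
  ultimately show ?thesis by (simp add: set_n_lists del: upt_Suc)
qed

lemma one_cycle_cS:
  assumes p: "p permutes {1..n}" and "one_cycle (one_line n p)"
  shows "p \<in> cS n"
  unfolding cS_iff
proof (intro conjI ballI impI p)
  fix x y assume xy: "x \<in> {1..n}" "y \<in> {1..n}" "p x \<noteq> x" "p y \<noteq> y"
  have in': "p z \<in> {1..n}" if "z \<in> {1..n}" for z using permutes_in_image[OF p] that by blast
  have l: "length (one_line n p) = n" by (simp add: one_line_def del: upt_Suc)
  have xy': "x \<in> set [1..<Suc n]" "y \<in> set [1..<Suc n]" using xy by auto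
  have "y \<in> {x, p x, p (p x), p (p (p x))}"
    using assms(2) xy' xy in' unfolding one_cycle_def Let_def l list_all_iff
    by (metis act_one_line)
  moreover have "x \<in> Orbits.orbit p x"
    using p by (intro permutation_self_in_orbit) (auto simp: permutation_permutes)
  ultimately show "y \<in> Orbits.orbit p x" by (auto intro: orbit.intros)
qed

lemma involution_cycle_cS:
  assumes p: "p permutes {1..n}" and "involution_cycle (one_line n p)"
  shows "p \<notin> cS n"
proof
  assume "p \<in> cS n"
  have in': "p z \<in> {1..n}" if "z \<in> {1..n}" for z using permutes_in_image[OF p] that by blast
  have l: "length (one_line n p) = n" by (simp add: one_line_def del: upt_Suc)
  obtain x y where "x \<in> set [1..<Suc n]" "y \<in> set [1..<Suc n]"
    and act: "act (one_line n p) x \<noteq> x" "act (one_line n p) y \<noteq> y"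
      "act (one_line n p) (act (one_line n p) x) = x" "y \<noteq> x" "y \<noteq> act (one_line n p) x"
    using assms(2) unfolding involution_cycle_def Let_def l list_ex_iff by blast
  then have xy: "x \<in> {1..n}" "y \<in> {1..n}" by auto
  then have p2: "p x \<noteq> x" "p y \<noteq> y" "p (p x) = x" "y \<noteq> x" "y \<noteq> p x"
    using act in' act_one_line by metis+
  have "z = x \<or> z = p x" if "z \<in> Orbits.orbit p x" for z
    using that by induction (auto simp: p2)
  then show False using \<open>p \<in> cS n\<close> xy p2 unfolding cS_iff by blast
qed

text \<open>The last two hypotheses make \<open>L\<close> the exact list of lines of
  \<open>cS n\<close>: its members pass the positive test and all other lines the negative
  one.\<close>

lemma connected_cS_lines:
  assumes "grows n L" "list_all one_cycle L" "list_all (\<lambda>l. l \<in> set L \<or> involution_cycle l) (all_lines n)"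
  shows "Digraph_Component.connected (Gamma_graph n (cS n))"
proof (rule connected_one_lines[OF cS_subset _ assms(1)])
  fix p assume p: "p permutes {1..n}"
  have "one_line n p \<in> set L \<or> involution_cycle (one_line n p)"
    using assms(3) one_line_all_lines[OF p] unfolding list_all_iff by blast
  then show "p \<in> cS n \<longleftrightarrow> one_line n p \<in> set L"
    using one_cycle_cS[OF p] involution_cycle_cS[OF p] assms(2) unfolding list_all_iff by blast
qed

definition lines2 :: "nat list list" where
  "lines2 = [[2, 1], [1, 2]]"

definition lines3 :: "nat list list" where
  "lines3 = [[3, 2, 1], [3, 1, 2], [2, 3, 1], [1, 3, 2], [2, 1, 3], [1, 2, 3]]"

text \<open>The 21 permutations of four points other than the three products of two disjoint
  transpositions, in an order that satisfies \<open>grows\<close>.\<close>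

definition cycle_lines4 :: "nat list list" where
  "cycle_lines4 = [[4, 3, 1, 2], [2, 4, 1, 3], [4, 2, 3, 1], [3, 4, 2, 1], [4, 2, 1, 3], [4, 1, 3, 2],
    [2, 4, 3, 1], [3, 2, 4, 1], [4, 1, 2, 3], [1, 4, 3, 2], [3, 1, 4, 2], [2, 3, 4, 1], [3, 2, 1, 4],
    [1, 4, 2, 3], [1, 3, 4, 2], [3, 1, 2, 4], [2, 3, 1, 4], [1, 2, 4, 3], [1, 3, 2, 4], [2, 1, 3, 4],
    [1, 2, 3, 4]]"

lemma connected_cS:
  assumes "1 \<le> n" "n \<le> 4"
  shows "Digraph_Component.connected (Gamma_graph n (cS n))"
proof -
  have "Digraph_Component.connected (Gamma_graph 1 (cS 1))"
    by (rule connected_cS_lines[of _ "[[1]]"]; code_simp)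
  moreover have "Digraph_Component.connected (Gamma_graph 2 (cS 2))"
    by (rule connected_cS_lines[of _ lines2]; code_simp)
  moreover have "Digraph_Component.connected (Gamma_graph 3 (cS 3))"
    by (rule connected_cS_lines[of _ lines3]; code_simp)
  moreover have "Digraph_Component.connected (Gamma_graph 4 (cS 4))"
    by (rule connected_cS_lines[of _ cycle_lines4]; code_simp)
  moreover have "n = 1 \<or> n = 2 \<or> n = 3 \<or> n = 4" using assms by auto
  ultimately show ?thesis by blast
qed

subsection \<open>Permutations generating a simple group\<close>

text \<open>The order of \<open>a\<close> divides the prime \<open>q\<close> and is not 1, so the
  generated group has prime order.\<close>

lemma (in group) simple_group_generate_prime_order:
  assumes a: "a \<in> carrier G" "a \<noteq> \<one>" and "prime (q :: nat)" "a [^] q = \<one>"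
  shows "simple_group (G\<lparr>carrier := generate G {a}\<rparr>)"
proof -
  have "ord a dvd q" using assms pow_eq_id by blast
  moreover have "ord a \<noteq> 1" using a ord_eq_1 by blast
  ultimately have "ord a = q" using assms(3) by (metis prime_nat_iff)
  moreover have "subgroup (generate G {a}) G" using a by (intro generate_is_subgroup) simp
  then have "Group.group (G\<lparr>carrier := generate G {a}\<rparr>)" by (rule subgroup_imp_group)
  ultimately show ?thesis
    using assms(3) generate_pow_card[OF a(1)]
    by (intro group.prime_order_simple) (simp_all add: order_def)
qed

text \<open>A cyclic group is abelian, so the subgroup generated by a nontrivial power is normal,
  and simplicity makes it the whole group. Finiteness lets every element be written as a power with
  a natural exponent.\<close>

lemma (in group) simple_group_generate_pow:
  assumes fin: "finite (carrier G)" and a: "a \<in> carrier G"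
    and simple: "simple_group (G\<lparr>carrier := generate G {a}\<rparr>)" and "a [^] (k :: nat) \<noteq> \<one>"
  shows "a \<in> generate G {a [^] k}"
proof -
  let ?C = "generate G {a}" and ?H = "generate G {a [^] k}"
  have C: "subgroup ?C G" and H: "subgroup ?H G"
    using a by (auto intro!: generate_is_subgroup)
  have gen: "?C = {a [^] m | m. m \<in> (UNIV :: nat set)}"
    by (rule generate_pow_on_finite_carrier[OF fin a])
  have "a [^] k \<in> ?C" using gen by blast
  then have sub: "?H \<subseteq> ?C" using generate_subgroup_incl[OF _ C] by blast
  have "comm_group (G\<lparr>carrier := ?C\<rparr>)"
  proof (rule group.group_comm_groupI[OF subgroup_imp_group[OF C]])
    fix x y assume "x \<in> carrier (G\<lparr>carrier := ?C\<rparr>)" "y \<in> carrier (G\<lparr>carrier := ?C\<rparr>)"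
    then obtain m m' :: nat where "x = a [^] m" "y = a [^] m'" using gen by auto
    then show "x \<otimes>\<^bsub>G\<lparr>carrier := ?C\<rparr>\<^esub> y = y \<otimes>\<^bsub>G\<lparr>carrier := ?C\<rparr>\<^esub> x"
      using a by (simp add: nat_pow_mult add.commute)
  qed
  then have "?H \<lhd> (G\<lparr>carrier := ?C\<rparr>)"
    using subgroup_incl[OF H C sub] by (rule comm_group.subgroup_imp_normal)
  then have "?H = ?C \<or> ?H = {\<one>}"
    using simple_group.no_real_normal_subgroup[OF simple] by auto
  moreover have "a \<in> ?C" "a [^] k \<in> ?H" by (auto intro: generate.incl)
  ultimately show ?thesis using assms(4) by auto
qed

section \<open>Powers in the symmetric group and membership in \<open>gS\<close>\<close>

lemma sym_group_pow: "p [^]\<^bsub>sym_group n\<^esub> (k :: nat) = p ^^ k"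
proof (induction k)
  case 0
  then show ?case by (simp add: nat_pow_0 sym_group_one)
next
  case (Suc k)
  have "p [^]\<^bsub>sym_group n\<^esub> Suc k = (p [^]\<^bsub>sym_group n\<^esub> k) \<otimes>\<^bsub>sym_group n\<^esub> p"
    by (simp add: nat_pow_def)
  then show ?case by (simp only: Suc sym_group_mult funpow_Suc_right)
qed

lemma finite_carrier_sym_group: "finite (carrier (sym_group n))"
  by (simp add: sym_group_def finite_permutations)

lemma gS_prime_order:
  assumes "p permutes {1..n}" "prime (q :: nat)" "p ^^ q = id"
  shows "p \<in> gS n"
  using group.simple_group_generate_prime_order[OF sym_group_is_group, of p n q] assms
  by (auto simp: gS_def sym_group_carrier sym_group_pow sym_group_one)

text \<open>A nontrivial square generates the whole simple group, so that \<open>p\<close> is a power of \<open>p \<circ> p\<close>.\<close>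

lemma gS_square_orbit:
  assumes "p \<in> gS n" "p \<circ> p \<noteq> id" "(p \<circ> p) ` S \<subseteq> S" "x \<in> S"
  shows "p x \<in> S"
proof -
  have p: "p \<in> carrier (sym_group n)" and "p \<noteq> id" using assms(1,2) by (auto simp: gS_def)
  then have "simple_group ((sym_group n)\<lparr>carrier := generate (sym_group n) {p}\<rparr>)"
    using assms(1) by (auto simp: gS_def)
  moreover have sq: "p [^]\<^bsub>sym_group n\<^esub> (2 :: nat) = p \<circ> p"
    unfolding sym_group_pow by (simp add: numeral_2_eq_2)
  ultimately have "p \<in> generate (sym_group n) {p \<circ> p}"
    using group.simple_group_generate_pow[OF sym_group_is_group finite_carrier_sym_group p, of 2] assms(2)
    unfolding sq by (simp add: sym_group_one)
  moreover have "p \<circ> p \<in> carrier (sym_group n)"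
    using p by (simp add: sym_group_carrier permutes_compose)
  ultimately obtain k :: nat where "p = (p \<circ> p) ^^ k"
    using group.generate_pow_on_finite_carrier[OF sym_group_is_group finite_carrier_sym_group, of "p \<circ> p" n]
    by (auto simp: sym_group_pow)
  moreover have "((p \<circ> p) ^^ m) x \<in> S" for m
    by (induction m) (use assms(3,4) in auto)
  ultimately show ?thesis by metis
qed

lemma gS_subset: "gS n \<subseteq> carrier (sym_group n)"
  by (auto simp: gS_def)

lemma not_connected_gS:
  assumes n: "4 \<le> n"
  shows "\<not> Digraph_Component.connected (Gamma_graph n (gS n))"
proof -
  define m where "m = n div 2"
  have m: "2 \<le> m" "n = 2 * m \<or> n = 2 * m + 1" using n by (auto simp: m_def)
  \<comment> \<open>\<open>p\<close> exchanges the two halves of \<open>{1..2 * m}\<close>; if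
    \<open>n\<close> is odd, it fixes \<open>n\<close>.\<close>
  define p where "p j = (if 1 \<le> j \<and> j \<le> m then j + m else if m < j \<and> j \<le> 2 * m then j - m else j)" for j
  have pp: "p \<circ> p = id" using m by (auto simp: p_def fun_eq_iff)
  have p: "p permutes {1..n}"
  proof (rule bij_imp_permutes)
    have img: "p ` {1..n} \<subseteq> {1..n}" using m by (auto simp: p_def)
    moreover have "inj_on p {1..n}" using pp by (metis inj_on_id inj_on_imageI2)
    ultimately show "bij_betw p {1..n} {1..n}" by (simp add: bij_betw_def endo_inj_surj)
  qed (use m in \<open>auto simp: p_def\<close>)
  show ?thesis
  proof (rule not_connected_Gamma_graphI[OF gS_subset, of p _ id])
    show "p \<in> gS n" using pp by (intro gS_prime_order[OF p two_is_prime_nat]) (simp add: numeral_2_eq_2)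
    show "id \<in> gS n" by (simp add: gS_def sym_group_carrier permutes_id)
    show "p \<noteq> id" using m by (auto simp: p_def fun_eq_iff intro!: exI[of _ 1])
    show "p \<circ> tau i \<notin> gS n" if i: "i \<in> {1..n - 1}" for i
    proof
      assume gS: "p \<circ> tau i \<in> gS n"
      have p_app: "p (p x) = x" for x using pp by (metis comp_apply id_apply)
      have s: "(p \<circ> tau i) i = p (Suc i)" "(p \<circ> tau i) (Suc i) = p i"
        "(p \<circ> tau i) x = p x" if "x \<noteq> i" "x \<noteq> Suc i" for x
        using that by (auto simp: tau_def)
      show False
      proof (cases "Suc i \<le> 2 * m")
        case True
        \<comment> \<open>The product has the 4-cycle \<open>i\<close>, \<open>p (Suc i)\<close>,
          \<open>Suc i\<close>, \<open>p i\<close>. Its square is nontrivial and preserves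
          \<open>{i, Suc i}\<close>, which the product itself does not.\<close>
        have ne: "p i \<noteq> i" "p i \<noteq> Suc i" "p (Suc i) \<noteq> i" "p (Suc i) \<noteq> Suc i"
          using True i m by (auto simp: p_def)
        have sq: "((p \<circ> tau i) \<circ> (p \<circ> tau i)) i = Suc i" "((p \<circ> tau i) \<circ> (p \<circ> tau i)) (Suc i) = i"
          using ne p_app by (auto simp: tau_def)
        have "(p \<circ> tau i) \<circ> (p \<circ> tau i) \<noteq> id" using sq(1) by (metis id_apply n_not_Suc_n)
        moreover have "((p \<circ> tau i) \<circ> (p \<circ> tau i)) ` {i, Suc i} \<subseteq> {i, Suc i}"
          by (simp only: image_insert image_empty sq) blast
        ultimately have "(p \<circ> tau i) i \<in> {i, Suc i}" using gS_square_orbit[OF gS] by blast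
        then show False using ne s(1) by (simp add: tau_def)
      next
        case False
        \<comment> \<open>Here \<open>n\<close> is odd and \<open>i = n - 1\<close>. The product has
          a 3-cycle on \<open>m\<close>, \<open>2 * m\<close>, \<open>2 * m + 1\<close> and, since
          \<open>2 \<le> m\<close>, the 2-cycle of 1 and \<open>m + 1\<close>. Its square is
          nontrivial and fixes 1, which the product moves.\<close>
        then have i': "i = 2 * m" using i m by auto
        have "((p \<circ> tau i) \<circ> (p \<circ> tau i)) 1 = 1" "(p \<circ> tau i) 1 \<noteq> 1"
          "((p \<circ> tau i) \<circ> (p \<circ> tau i)) i \<noteq> i"
          using m by (auto simp: p_def tau_def Transposition.transpose_def i')
        then show False
          using gS_square_orbit[OF gS, of "{1}" 1] by (auto simp: fun_eq_iff)
      qed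
    qed
  qed
qed

section \<open>Certificates for permutations of order dividing two or three\<close>

definition prime_order_line :: "nat list \<Rightarrow> bool" where
  "prime_order_line l \<longleftrightarrow> (let xs = [1..<Suc (length l)] in
     list_all (\<lambda>x. act l (act l x) = x) xs \<or> list_all (\<lambda>x. act l (act l (act l x)) = x) xs)"

lemma prime_order_line_gS:
  assumes p: "p permutes {1..n}" and "prime_order_line (one_line n p)"
  shows "p \<in> gS n"
proof -
  have in': "p z \<in> {1..n}" if "z \<in> {1..n}" for z using permutes_in_image[OF p] that by blast
  have out: "p z = z" if "z \<notin> {1..n}" for z using permutes_not_in[OF p] that by blast
  have l: "length (one_line n p) = n" by (simp add: one_line_def del: upt_Suc)
  have set: "set [1..<Suc n] = {1..n}" by auto
  have "(\<forall>x\<in>{1..n}. p (p x) = x) \<or> (\<forall>x\<in>{1..n}. p (p (p x)) = x)"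
    using assms(2) in' unfolding prime_order_line_def Let_def l list_all_iff set
    by (metis act_one_line)
  then have "(\<forall>x. p (p x) = x) \<or> (\<forall>x. p (p (p x)) = x)" using out by metis
  then have "p ^^ 2 = id \<or> p ^^ 3 = id"
    by (auto simp: fun_eq_iff numeral_2_eq_2 numeral_3_eq_3)
  then show ?thesis using gS_prime_order[OF p, of 2] gS_prime_order[OF p, of 3] by auto
qed

text \<open>The second hypothesis forces \<open>gS n\<close> to be the whole symmetric group. This
  is the situation for \<open>n \<le> 3\<close>, where every element has order 1, 2 or 3.\<close>

lemma connected_gS_lines:
  assumes "grows n L" "list_all (\<lambda>l. l \<in> set L \<and> prime_order_line l) (all_lines n)"
  shows "Digraph_Component.connected (Gamma_graph n (gS n))"
proof (rule connected_one_lines[OF gS_subset _ assms(1)])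
  fix p assume p: "p permutes {1..n}"
  have "one_line n p \<in> set L" "prime_order_line (one_line n p)"
    using assms(2) one_line_all_lines[OF p] unfolding list_all_iff by blast+
  then show "p \<in> gS n \<longleftrightarrow> one_line n p \<in> set L"
    using prime_order_line_gS[OF p] by blast
qed

lemma connected_gS:
  assumes "1 \<le> n" "n \<le> 3"
  shows "Digraph_Component.connected (Gamma_graph n (gS n))"
proof -
  have "Digraph_Component.connected (Gamma_graph 1 (gS 1))"
    by (rule connected_gS_lines[of _ "[[1]]"]; code_simp)
  moreover have "Digraph_Component.connected (Gamma_graph 2 (gS 2))"
    by (rule connected_gS_lines[of _ lines2]; code_simp)
  moreover have "Digraph_Component.connected (Gamma_graph 3 (gS 3))"
    by (rule connected_gS_lines[of _ lines3]; code_simp)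
  moreover have "n = 1 \<or> n = 2 \<or> n = 3" using assms by auto
  ultimately show ?thesis by blast
qed

theorem theorem1p10:
  fixes n :: nat
  assumes "n \<ge> 1"
  shows "(Digraph_Component.connected (Gamma_graph n (bS n)) \<and> (planar (Gamma_graph n (bS n)) \<longleftrightarrow> n \<le> 6)) \<and>
         (Digraph_Component.connected (Gamma_graph n (cS n)) \<longleftrightarrow> n \<le> 4) \<and>
         (Digraph_Component.connected (Gamma_graph n (gS n)) \<longleftrightarrow> n \<le> 3)"
proof (intro conjI iffI)
  show "Digraph_Component.connected (Gamma_graph n (bS n))" by (rule connected_bS)
  show "n \<le> 6" if "planar (Gamma_graph n (bS n))"
    using Gamma_bS_not_planar[of n] that by linarith
  show "planar (Gamma_graph n (bS n))" if "n \<le> 6"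
    using planar_bS_mono[OF planar_bS_6 that] .
  show "n \<le> 4" if "Digraph_Component.connected (Gamma_graph n (cS n))"
    using not_connected_cS[of n] that by linarith
  show "n \<le> 3" if "Digraph_Component.connected (Gamma_graph n (gS n))"
    using not_connected_gS[of n] that by linarith
qed (use assms connected_cS connected_gS in blast)+

end
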